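(* Let $f$ and $g$ satisfy the standing assumptions (A) of the context and take $\gamma\in(0,1/L)$, where $L$ is the Lipschitz constant of $\nabla f$. Assume that the general structure-exploiting proximal algorithm described in the context generates a sequence $(y_k)$ which admits at least one limit point $\bar x$ such that: (i) $\bar x\in\mathcal{M}$ is an $r$-structured critical point for $(f,g)$ with $r<1/\gamma$, where $\mathcal{M}$ is a $\mathcal{C}^2$ submanifold of $\mathbb{R}^n$; (ii) the manifold update $\mathrm{ManAcc}_{\mathcal{M}}$ has superlinear convergence rate of order $1+\theta\in(1,2)$ near $\bar x$ in $\mathcal{M}$. Then, after some finite time: (a) the full sequence $(x_k)$ lies on $\mathcal{M}$; (b) $x_k$ converges to $\bar x$ superlinearly with the same order as $\mathrm{ManAcc}_{\mathcal{M}}$: there is $c>0$ such that, for all sufficiently large $k$, $$\mathrm{dist}_{\mathcal{M}}(x_{k+1},\bar x)\le c\,\mathrm{dist}_{\mathcal{M}}(x_k,\bar x)^{1+\theta}.$$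
   Context: Standing assumptions (A): $f,g$ are proper; $f:\mathbb{R}^n\to\mathbb{R}$ is $\mathcal{C}^2$ with $L$-Lipschitz gradient; $g:\mathbb{R}^n\to\mathbb{R}\cup\{+\infty\}$ is lower semi-continuous; $\mathrm{prox}_{\gamma g}$ is non-empty on $\mathbb{R}^n$ for any $\gamma>0$; $F=f+g$ is bounded below. Here $\mathrm{prox}_{\gamma g}(y)=\operatorname{argmin}_{u}\{g(u)+\frac{1}{2\gamma}\|u-y\|^2\}$ (set-valued). Algorithm: from an arbitrary starting point, iterate for $k=1,2,\dots$: (1) compute $x_k\in\mathrm{prox}_{\gamma g}(y_{k-1}-\gamma\nabla f(y_{k-1}))$ and get a submanifold $\mathcal{M}_k\ni x_k$ (the current active manifold, delivered along with the proximal point); (2) set $y_k=\mathrm{ManAcc}_{\mathcal{M}_k}(x_k)\in\mathcal{M}_k$. Here, for each manifold $\mathcal{N}$, $\mathrm{ManAcc}_{\mathcal{N}}$ is a given update map from $\mathcal{N}$ to $\mathcal{N}$. The returned manifold is the active one, so that $\mathcal{M}_k=\mathcal{M}$ whenever $x_k\in\mathcal{M}$ is close enough to $\bar x$. Distance and rate: $\mathrm{dist}_{\mathcal{M}}$ is the Riemannian distance on $\mathcal{M}$ (infimum of lengths of curves in $\mathcal{M}$, with the metric induced by $\mathbb{R}^n$). $\mathrm{ManAcc}_{\mathcal{M}}$ has superlinear convergence rate of order $1+\theta$ near $\bar x$ in $\mathcal{M}$ if there are $\varepsilon,q>0$ such that $\mathrm{dist}_{\mathcal{M}}(\mathrm{ManAcc}_{\mathcal{M}}(x),\bar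 x)\le q\,\mathrm{dist}_{\mathcal{M}}(x,\bar x)^{1+\theta}$ for all $x\in\mathcal{M}$ with $\mathrm{dist}_{\mathcal{M}}(x,\bar x)\le\varepsilon$. A limit point is the limit of a subsequence. Subdifferentials: the regular subdifferential is $\widehat\partial g(\bar x)=\{v: g(x)\ge g(\bar x)+\langle v,x-\bar x\rangle+o(\|x-\bar x\|)\}$, and the limiting subdifferential is $\partial g(\bar x)=\{\lim_k v_k: v_k\in\widehat\partial g(x_k),\ x_k\to\bar x,\ g(x_k)\to g(\bar x)\}$. $g$ is (Clarke) regular at $\bar x$ if the two coincide there. $\mathrm{ri}$ denotes relative interior. Prox-regularity ($r>0$): $g$ is $r$-prox-regular at $\bar x$ if $g$ is finite and locally lower semi-continuous at $\bar x$ and for every $\bar v\in\partial g(\bar x)$ there is $\varepsilon>0$ such that $g(x')\ge g(x)+\langle v,x'-x\rangle-\frac r2\|x'-x\|^2$ whenever $v\in\partial g(x)$, $\|x-\bar x\|<\varepsilon$, $\|x'-\bar x\|<\varepsilon$, $\|v-\bar v\|<\varepsilon$, $g(x)<g(\bar x)+\varepsilon$. Partial smoothness: $g$ is partly smooth at $\bar x$ relative to $\mathcal{M}\ni\bar x$ if $\mathcal{M}$ is a $\mathcal{C}^2$ submanifold of $\mathbb{R}^n$ around $\bar x$ and: the restriction of $g$ to $\mathcal{M}$ is $\mathcal{C}^2$ near $\bar x$; $g$ is Clarke regular at all $x\in\mathcal{M}$ near $\bar x$, with $\partial g(x)\ne\emptyset$; the affine span of $\partial g(\bar x)$ is a translate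 of the normal space $N_{\bar x}\mathcal{M}$; the set-valued map $\partial g$ restricted to $\mathcal{M}$ is continuous at $\bar x$. $r$-structured critical point: $\bar x\in\mathcal{M}$ is an $r$-structured critical point for $(f,g)$ if (i) $\bar x=\mathrm{prox}_{g/r}(\bar x-\frac1r\nabla f(\bar x))$ (the prox set is exactly $\{\bar x\}$); (ii) $0\in\mathrm{ri}(\nabla f(\bar x)+\partial g(\bar x))$; (iii) $g$ is $r$-prox-regular at $\bar x$; (iv) $g$ is partly smooth at $\bar x$ relative to $\mathcal{M}$. *)

theory Defs
  imports "HOL-Analysis.Analysis"
begin

definition grad :: "('a::euclidean_space \<Rightarrow> real) \<Rightarrow> 'a \<Rightarrow> 'a" where
  "grad f x = (THE D. GDERIV f x :> D)"

definition C2_on :: "'a::real_normed_vector set \<Rightarrow> ('a \<Rightarrow> 'b::real_normed_vector) \<Rightarrow> bool" where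
  "C2_on U f \<longleftrightarrow> open U \<and>
    (\<exists>(f' :: 'a \<Rightarrow> 'a \<Rightarrow>\<^sub>L 'b) (f'' :: 'a \<Rightarrow> 'a \<Rightarrow>\<^sub>L 'a \<Rightarrow>\<^sub>L 'b).
      (\<forall>x\<in>U. (f has_derivative blinfun_apply (f' x)) (at x)) \<and>
      (\<forall>x\<in>U. (f' has_derivative blinfun_apply (f'' x)) (at x)) \<and>
      continuous_on U f'')"

definition proper :: "('a \<Rightarrow> ereal) \<Rightarrow> bool" where
  "proper g \<longleftrightarrow> (\<forall>x. g x \<noteq> -\<infinity>) \<and> (\<exists>x. g x \<noteq> \<infinity>)"

definition lsc :: "('a::topological_space \<Rightarrow> ereal) \<Rightarrow> bool" where
  "lsc g \<longleftrightarrow> (\<forall>x. g x \<le> Liminf (at x) g)"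

(* Local lower semicontinuity at a point as in Rockafellar and Wets, Variational Analysis. *)
definition locally_lsc_at :: "('a::metric_space \<Rightarrow> ereal) \<Rightarrow> 'a \<Rightarrow> bool" where
  "locally_lsc_at g x \<longleftrightarrow>
    (\<exists>\<epsilon>>0. \<forall>\<alpha>::real. ereal \<alpha> \<le> g x + ereal \<epsilon> \<longrightarrow> closed {z \<in> cball x \<epsilon>. g z \<le> ereal \<alpha>})"

(* prox \<gamma> g y is the argmin set of u \<mapsto> g u + |u - y|^2 / (2 \<gamma>),
   that is, the proximal operator of \<gamma> g. *)
definition prox :: "real \<Rightarrow> ('a::euclidean_space \<Rightarrow> ereal) \<Rightarrow> 'a \<Rightarrow> 'a set" where
  "prox \<gamma> g y = {u. \<forall>w. g u + ereal (1 / (2 * \<gamma>) * (norm (u - y))\<^sup>2)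
                       \<le> g w + ereal (1 / (2 * \<gamma>) * (norm (w - y))\<^sup>2)}"

definition standing_assumptions ::
  "('a::euclidean_space \<Rightarrow> real) \<Rightarrow> ('a \<Rightarrow> ereal) \<Rightarrow> real \<Rightarrow> bool" where
  "standing_assumptions f g L \<longleftrightarrow>
    C2_on UNIV f \<and> L-lipschitz_on UNIV (grad f) \<and>
    proper g \<and> lsc g \<and>
    (\<forall>\<gamma>>0. \<forall>y. prox \<gamma> g y \<noteq> {}) \<and>
    (\<exists>B::real. \<forall>x. ereal B \<le> ereal (f x) + g x)"

(* Both subdifferentials are empty outside the domain of g.  In the regular one, the term
   o(|z - x|) is spelled out: the inequality holds near x up to \<epsilon> |z - x|, for every \<epsilon> > 0. *)
definition regular_subdiff :: "('a::euclidean_space \<Rightarrow> ereal) \<Rightarrow> 'a \<Rightarrow> 'a set" where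
  "regular_subdiff g x = {v. \<bar>g x\<bar> \<noteq> \<infinity> \<and>
     (\<forall>\<epsilon>>0. \<forall>\<^sub>F z in nhds x. g z \<ge> g x + ereal (v \<bullet> (z - x) - \<epsilon> * norm (z - x)))}"

definition limiting_subdiff :: "('a::euclidean_space \<Rightarrow> ereal) \<Rightarrow> 'a \<Rightarrow> 'a set" where
  "limiting_subdiff g x = {v. \<bar>g x\<bar> \<noteq> \<infinity> \<and>
     (\<exists>X V. (\<forall>k. V k \<in> regular_subdiff g (X k)) \<and> X \<longlonglongrightarrow> x \<and>
            (\<lambda>k. g (X k)) \<longlonglongrightarrow> g x \<and> V \<longlonglongrightarrow> v)}"

definition clarke_regular :: "('a::euclidean_space \<Rightarrow> ereal) \<Rightarrow> 'a \<Rightarrow> bool" where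
  "clarke_regular g x \<longleftrightarrow> regular_subdiff g x = limiting_subdiff g x"

definition prox_regular :: "real \<Rightarrow> ('a::euclidean_space \<Rightarrow> ereal) \<Rightarrow> 'a \<Rightarrow> bool" where
  "prox_regular r g x0 \<longleftrightarrow> r > 0 \<and> \<bar>g x0\<bar> \<noteq> \<infinity> \<and> locally_lsc_at g x0 \<and>
    (\<forall>v0 \<in> limiting_subdiff g x0. \<exists>\<epsilon>>0. \<forall>x x' v.
       v \<in> limiting_subdiff g x \<and> norm (x - x0) < \<epsilon> \<and> norm (x' - x0) < \<epsilon> \<and>
       norm (v - v0) < \<epsilon> \<and> g x < g x0 + ereal \<epsilon> \<longrightarrow>
       g x' \<ge> g x + ereal (v \<bullet> (x' - x) - r / 2 * (norm (x' - x))\<^sup>2))"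

(* M is a p-dimensional C2 submanifold around x: near x, M is the zero set of a C2 map \<Phi> into
   a space of dimension n - p, with surjective derivative at x.  The codomain, of varying
   dimension, is represented by a linear subspace W of the ambient space. *)
definition C2_submanifold_at :: "nat \<Rightarrow> 'a::euclidean_space set \<Rightarrow> 'a \<Rightarrow> bool" where
  "C2_submanifold_at p M x \<longleftrightarrow> x \<in> M \<and>
    (\<exists>U W (\<Phi> :: 'a \<Rightarrow> 'a). open U \<and> x \<in> U \<and> subspace W \<and> dim W + p = DIM('a) \<and>
       \<Phi> ` U \<subseteq> W \<and> C2_on U \<Phi> \<and> range (frechet_derivative \<Phi> (at x)) = W \<and>
       (\<forall>z\<in>U. z \<in> M \<longleftrightarrow> \<Phi> z = 0))"

definition C2_submanifold :: "'a::euclidean_space set \<Rightarrow> bool" where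
  "C2_submanifold M \<longleftrightarrow> (\<exists>p. \<forall>x\<in>M. C2_submanifold_at p M x)"

definition tangent_space :: "'a::euclidean_space set \<Rightarrow> 'a \<Rightarrow> 'a set" where
  "tangent_space M x = {v. \<exists>c e. e > 0 \<and> c C1_differentiable_on {-e<..<e} \<and>
     c ` {-e<..<e} \<subseteq> M \<and> c 0 = x \<and> (c has_vector_derivative v) (at 0)}"

definition normal_space :: "'a::euclidean_space set \<Rightarrow> 'a \<Rightarrow> 'a set" where
  "normal_space M x = orthogonal_comp (tangent_space M x)"

(* Continuity at x of S restricted to M, in the Painleve-Kuratowski sense:
   outer and inner semicontinuity. *)
definition setvalued_continuous_within ::
  "('a::euclidean_space \<Rightarrow> 'a set) \<Rightarrow> 'a set \<Rightarrow> 'a \<Rightarrow> bool" where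
  "setvalued_continuous_within S M x \<longleftrightarrow>
    (\<forall>X V v. (\<forall>k. X k \<in> M) \<and> X \<longlonglongrightarrow> x \<and> (\<forall>k. V k \<in> S (X k)) \<and> V \<longlonglongrightarrow> v \<longrightarrow> v \<in> S x) \<and>
    (\<forall>v \<in> S x. \<forall>X. (\<forall>k. X k \<in> M) \<and> X \<longlonglongrightarrow> x \<longrightarrow>
       (\<exists>V. (\<forall>\<^sub>F k in sequentially. V k \<in> S (X k)) \<and> V \<longlonglongrightarrow> v))"

(* The restriction of g to M is C2 near x when it agrees there with a real-valued C2 function
   defined on an open subset of the ambient space. *)
definition partly_smooth :: "('a::euclidean_space \<Rightarrow> ereal) \<Rightarrow> 'a set \<Rightarrow> 'a \<Rightarrow> bool" where
  "partly_smooth g M x \<longleftrightarrow>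
    (\<exists>p. C2_submanifold_at p M x) \<and>
    (\<exists>U h. x \<in> U \<and> C2_on U h \<and> (\<forall>z \<in> M \<inter> U. g z = ereal (h z))) \<and>
    (\<forall>\<^sub>F z in nhds x. z \<in> M \<longrightarrow> clarke_regular g z \<and> limiting_subdiff g z \<noteq> {}) \<and>
    (\<exists>a. affine hull (limiting_subdiff g x) = (+) a ` normal_space M x) \<and>
    setvalued_continuous_within (limiting_subdiff g) M x"

definition structured_critical_point ::
  "real \<Rightarrow> ('a::euclidean_space \<Rightarrow> real) \<Rightarrow> ('a \<Rightarrow> ereal) \<Rightarrow> 'a set \<Rightarrow> 'a \<Rightarrow> bool" where
  "structured_critical_point r f g M x \<longleftrightarrow> x \<in> M \<and>
    prox (1 / r) g (x - (1 / r) *\<^sub>R grad f x) = {x} \<and>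
    0 \<in> rel_interior ((+) (grad f x) ` limiting_subdiff g x) \<and>
    prox_regular r g x \<and>
    partly_smooth g M x"

(* A Lebesgue integral in [0, \<infinity>]: a valid path is only piecewise C1 on open pieces, so its speed
   may fail to be integrable, and its length is then \<infinity>. *)
definition curve_length :: "(real \<Rightarrow> 'a::euclidean_space) \<Rightarrow> ennreal" where
  "curve_length c = (\<integral>\<^sup>+ t\<in>{0..1}. ennreal (norm (vector_derivative c (at t))) \<partial>lborel)"

(* The distance between points that no curve in M joins is \<infinity>. *)
definition riem_dist :: "'a::euclidean_space set \<Rightarrow> 'a \<Rightarrow> 'a \<Rightarrow> ennreal" where
  "riem_dist M a b =
    (INF c \<in> {c. valid_path c \<and> path_image c \<subseteq> M \<and> pathstart c = a \<and> pathfinish c = b}.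
       curve_length c)"

(* Only used with p > 0. *)
definition ennreal_powr :: "ennreal \<Rightarrow> real \<Rightarrow> ennreal" where
  "ennreal_powr d p = (if d = \<infinity> then \<infinity> else ennreal (enn2real d powr p))"

definition superlinear_rate_near ::
  "('a::euclidean_space \<Rightarrow> 'a) \<Rightarrow> 'a set \<Rightarrow> 'a \<Rightarrow> real \<Rightarrow> bool" where
  "superlinear_rate_near T M x0 p \<longleftrightarrow>
    (\<exists>\<epsilon>>0. \<exists>q>0. \<forall>x\<in>M. riem_dist M x x0 \<le> ennreal \<epsilon> \<longrightarrow>
       riem_dist M (T x) x0 \<le> ennreal q * ennreal_powr (riem_dist M x x0) p)"

(* A run of the algorithm started at y 0; x 0 and Mk 0 are irrelevant. *)
definition structured_prox_run ::
  "('a::euclidean_space \<Rightarrow> real) \<Rightarrow> ('a \<Rightarrow> ereal) \<Rightarrow> real \<Rightarrow> ('a set \<Rightarrow> 'a \<Rightarrow> 'a) \<Rightarrow>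
   (nat \<Rightarrow> 'a) \<Rightarrow> (nat \<Rightarrow> 'a) \<Rightarrow> (nat \<Rightarrow> 'a set) \<Rightarrow> bool" where
  "structured_prox_run f g \<gamma> ManAcc x y Mk \<longleftrightarrow>
    (\<forall>k\<ge>1. x k \<in> prox \<gamma> g (y (k - 1) - \<gamma> *\<^sub>R grad f (y (k - 1))) \<and>
           C2_submanifold (Mk k) \<and> x k \<in> Mk k \<and>
           y k = ManAcc (Mk k) (x k))"

end

theory Submission
  imports Defs
begin

text \<open>Comparing the optimality of \<open>x\<^sub>k\<close> in the proximal step with that of \<open>xbar\<close> at parameter \<open>1/r\<close>
  gives \<open>|x\<^sub>k - xbar| \<le> C |y\<^sub>k\<^sub>-\<^sub>1 - xbar|\<close>, and partial smoothness with prox-regularity forces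
  \<open>x\<^sub>k \<in> M\<close> once \<open>y\<^sub>k\<^sub>-\<^sub>1\<close> is close to \<open>xbar\<close>.  On \<open>M\<close> near \<open>xbar\<close> the Riemannian and Euclidean distances
  are equivalent, so a proximal step costs a constant factor while the manifold step is superlinear.
  Hence once some \<open>y\<^sub>k\<close> is close enough to \<open>xbar\<close>, the iterates contract towards it and never leave
  that neighbourhood.\<close>

text \<open>The rate of the manifold update is given in \<open>riem_dist\<close>, the proximal step
  is controlled only in the Euclidean norm, and the two comparisons have unequal strength: the norm
  is below \<open>riem_dist\<close> globally and for every set, while the converse bound, with
  factor 3, is local at \<open>xbar\<close>. This fixes the order of conversions: \<open>x k\<close>
  is brought near \<open>xbar\<close> in norm, then in \<open>riem_dist\<close>, and
  \<open>y k\<close> returns to the norm without prior knowledge of where it lies. Only constant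
  factors enter, so the exponent \<open>1 + \<theta>\<close> survives.

  Identification is needed with one radius for all inputs of the proximal step, hence it is proved
  by contradiction with arbitrary sequences and not along the run. In place of a nearest point of
  \<open>M\<close> it uses orthogonal projection in straightened coordinates; a difference that is
  normal up to a small relative error suffices, because differences are normalised before passing to
  the limit.\<close>

section \<open>Proximal points: inequalities, subgradients, calmness\<close>

lemma prox_finite:
  assumes "proper g" "u \<in> prox \<gamma> g p"
  shows "\<bar>g u\<bar> \<noteq> \<infinity>"
proof -
  obtain w where "g w \<noteq> \<infinity>" using assms(1) unfolding proper_def by blast
  moreover have "g u + ereal (1 / (2 * \<gamma>) * (norm (u - p))\<^sup>2) \<le> g w + ereal (1 / (2 * \<gamma>) * (norm (w - p))\<^sup>2)"
    using assms(2) unfolding prox_def by blast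
  ultimately have "g u \<noteq> \<infinity>" by auto
  then show ?thesis using assms(1) unfolding proper_def by auto
qed

lemma norm_diff_sq_expand:
  fixes a b p :: "'a::real_inner"
  shows "(norm (a - p))\<^sup>2 = (norm (b - p))\<^sup>2 + 2 * ((a - b) \<bullet> (b - p)) + (norm (a - b))\<^sup>2"
  by (simp add: power2_norm_eq_inner inner_diff inner_commute)

text \<open>Expanding the square about \<open>u\<close> leaves a linear term and
  \<open>|w - u|^2\<close>. The inequality serves to test a proximal point against
  \<open>xb\<close>, to test \<open>xb\<close> against that point, and to produce a
  subgradient.\<close>

lemma prox_ineq_real:
  assumes "u \<in> prox \<gamma> g p" "g u = ereal a" "g w = ereal b" "\<gamma> > 0"
  shows "a \<le> b + (w - u) \<bullet> (u - p) / \<gamma> + (norm (w - u))\<^sup>2 / (2 * \<gamma>)"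
proof -
  have "g u + ereal (1 / (2 * \<gamma>) * (norm (u - p))\<^sup>2) \<le> g w + ereal (1 / (2 * \<gamma>) * (norm (w - p))\<^sup>2)"
    using assms(1) unfolding prox_def by blast
  then have "a + 1 / (2 * \<gamma>) * (norm (u - p))\<^sup>2 \<le> b + 1 / (2 * \<gamma>) * (norm (w - p))\<^sup>2"
    using assms by simp
  then show ?thesis
    unfolding norm_diff_sq_expand[of w p u] using \<open>\<gamma> > 0\<close> by (simp add: field_simps)
qed

text \<open>The remainder \<open>|z - u|^2 / (2 \<gamma>)\<close> of the proximal inequality is
  \<open>o(|z - u|)\<close>: it is at most \<open>\<epsilon> |z - u|\<close> within the radius
  \<open>2 \<gamma> \<epsilon>\<close>.\<close>

lemma prox_subgradient:
  assumes "proper g" "u \<in> prox \<gamma> g p" "\<gamma> > 0"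
  shows "(p - u) /\<^sub>R \<gamma> \<in> regular_subdiff g u"
proof -
  have fin: "\<bar>g u\<bar> \<noteq> \<infinity>" using prox_finite[OF assms(1,2)] .
  then obtain a where a: "g u = ereal a" by auto
  have "\<forall>\<^sub>F z in nhds u. g z \<ge> g u + ereal (((p - u) /\<^sub>R \<gamma>) \<bullet> (z - u) - \<epsilon> * norm (z - u))"
    if "\<epsilon> > 0" for \<epsilon>
  proof -
    have "g z \<ge> g u + ereal (((p - u) /\<^sub>R \<gamma>) \<bullet> (z - u) - \<epsilon> * norm (z - u))"
      if z: "dist z u < 2 * \<gamma> * \<epsilon>" for z
    proof (cases "g z")
      case (real b)
      have "a \<le> b + (z - u) \<bullet> (u - p) / \<gamma> + (norm (z - u))\<^sup>2 / (2 * \<gamma>)"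
        using prox_ineq_real[OF assms(2) a real assms(3)] .
      moreover have "(norm (z - u))\<^sup>2 / (2 * \<gamma>) \<le> \<epsilon> * norm (z - u)"
      proof -
        have "norm (z - u) * norm (z - u) \<le> (2 * \<gamma> * \<epsilon>) * norm (z - u)"
          using z by (intro mult_right_mono) (auto simp: dist_norm)
        then show ?thesis using \<open>\<gamma> > 0\<close> by (simp add: field_simps power2_eq_square)
      qed
      moreover have "((p - u) /\<^sub>R \<gamma>) \<bullet> (z - u) = - ((z - u) \<bullet> (u - p) / \<gamma>)"
        by (simp add: inner_commute inner_diff diff_divide_distrib add_divide_distrib divide_inverse algebra_simps)
      ultimately show ?thesis using a real by simp
    next
      case MInf
      then show ?thesis using assms(1) unfolding proper_def by auto
    qed auto
    then show ?thesis
      unfolding eventually_nhds_metric using \<open>\<epsilon> > 0\<close> \<open>\<gamma> > 0\<close> by (intro exI[of _ "2 * \<gamma> * \<epsilon>"]) auto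
  qed
  then show ?thesis unfolding regular_subdiff_def using fin by blast
qed

lemma regular_subset_limiting_subdiff: "regular_subdiff g u \<subseteq> limiting_subdiff g u"
proof
  fix v assume v: "v \<in> regular_subdiff g u"
  show "v \<in> limiting_subdiff g u"
    unfolding limiting_subdiff_def
    by (rule CollectI, intro conjI exI[of _ "\<lambda>_. u"] exI[of _ "\<lambda>_. v"])
       (use v in \<open>auto simp: regular_subdiff_def\<close>)
qed

text \<open>The only minimality used at \<^term>\<open>xb\<close> is the prox inequality with parameter \<open>1/r\<close>; it bounds
  \<^term>\<open>g\<close> below by a concave quadratic of curvature \<open>-r\<close>, weaker than the curvature \<open>1/\<gamma>\<close> of the
  proximal term, which yields a global Lipschitz estimate at \<^term>\<open>xb\<close>.\<close>
lemma prox_grad_calm: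
  fixes f :: "'a::euclidean_space \<Rightarrow> real"
  assumes "proper g" and lip: "L-lipschitz_on UNIV (grad f)"
    and "0 < \<gamma>" "0 < r" "r < 1 / \<gamma>"
    and xb: "xb \<in> prox (1 / r) g (xb - (1 / r) *\<^sub>R grad f xb)"
    and x: "x \<in> prox \<gamma> g (y - \<gamma> *\<^sub>R grad f y)"
  shows "(1 / \<gamma> - r) * norm (x - xb) \<le> 2 * (L + 1 / \<gamma>) * norm (y - xb)"
proof -
  obtain a where a: "g x = ereal a" using prox_finite[OF assms(1) x] by auto
  obtain b where b: "g xb = ereal b" using prox_finite[OF assms(1) xb] by auto
  define u where "u = x - xb"
  have 1: "a \<le> b + (- u) \<bullet> (x - (y - \<gamma> *\<^sub>R grad f y)) / \<gamma> + (norm u)\<^sup>2 / (2 * \<gamma>)"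
    using prox_ineq_real[OF x a b \<open>0 < \<gamma>\<close>] by (simp add: u_def norm_minus_commute)
  have 2: "b \<le> a + u \<bullet> grad f xb + r / 2 * (norm u)\<^sup>2"
    using prox_ineq_real[OF xb b a] \<open>0 < r\<close> by (simp add: u_def mult.commute)
  have e: "(- u) \<bullet> (x - (y - \<gamma> *\<^sub>R grad f y)) / \<gamma> = - (norm u)\<^sup>2 / \<gamma> + u \<bullet> ((y - xb) /\<^sub>R \<gamma> - grad f y)"
    using \<open>0 < \<gamma>\<close> by (simp add: u_def power2_norm_eq_inner inner_diff inner_add inner_commute field_simps)
  \<comment> \<open>Adding \<open>1\<close> and \<open>2\<close> cancels the values of
    \<open>g\<close>; the curvature \<open>r / 2\<close> from \<open>xb\<close> is absorbed by
    \<open>1 / (2 \<gamma>)\<close>. The factor 2 in the claim clears the halves.\<close>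
  have "(1 / \<gamma> - r) / 2 * (norm u)\<^sup>2 \<le> u \<bullet> ((y - xb) /\<^sub>R \<gamma> + (grad f xb - grad f y))"
  proof -
    have "(norm u)\<^sup>2 / (2 * \<gamma>) = (norm u)\<^sup>2 / \<gamma> / 2"
      "(1 / \<gamma> - r) / 2 * (norm u)\<^sup>2 = (norm u)\<^sup>2 / \<gamma> / 2 - r / 2 * (norm u)\<^sup>2"
      by (simp_all add: algebra_simps diff_divide_distrib)
    then show ?thesis using 1 2 unfolding e by (simp add: inner_diff_right inner_add_right)
  qed
  also have "\<dots> \<le> norm u * (norm ((y - xb) /\<^sub>R \<gamma>) + norm (grad f xb - grad f y))"
    by (rule order_trans[OF norm_cauchy_schwarz mult_left_mono[OF norm_triangle_ineq]]) simp
  also have "\<dots> \<le> norm u * (norm (y - xb) / \<gamma> + L * norm (y - xb))"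
    using lipschitz_onD[OF lip, of xb y] \<open>0 < \<gamma>\<close>
    by (intro mult_left_mono add_mono) (auto simp: dist_norm norm_minus_commute divide_inverse mult.commute)
  finally have "norm u * ((1 / \<gamma> - r) * norm u) \<le> norm u * (2 * (L + 1 / \<gamma>) * norm (y - xb))"
    by (simp add: power2_eq_square algebra_simps)
  moreover have "0 \<le> 2 * (L + 1 / \<gamma>) * norm (y - xb)"
    using lipschitz_on_nonneg[OF lip] \<open>0 < \<gamma>\<close> by (intro mult_nonneg_nonneg) auto
  ultimately show ?thesis
    unfolding u_def[symmetric] by (cases "u = 0") (auto simp: mult_le_cancel_left)
qed

section \<open>Euclidean distance below Riemannian distance\<close>

text \<open>A finite length makes the velocity Lebesgue integrable. The gauge integral of the
  fundamental theorem of calculus is then a Lebesgue integral, and its norm is at most the integral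
  of the speed.\<close>

lemma norm_le_curve_length:
  fixes c :: "real \<Rightarrow> 'a::euclidean_space"
  assumes "valid_path c"
  shows "ennreal (norm (pathfinish c - pathstart c)) \<le> curve_length c"
proof (cases "curve_length c = \<infinity>")
  case False
  obtain S where S: "finite S" "c C1_differentiable_on ({0..1} - S)" and cont: "continuous_on {0..1} c"
    using assms unfolding valid_path_def piecewise_C1_differentiable_on_def by auto
  define v where "v t = vector_derivative c (at t)" for t
  \<comment> \<open>The velocity is controlled only off the finite set \<open>S\<close>; setting it
    to 0 there and outside the unit interval gives a function that is measurable on the whole line
    and has the same integral.\<close>
  define s where "s t = (if t \<in> S then 0 else indicator {0..1} t *\<^sub>R v t)" for t
  have ftc: "(v has_integral (c 1 - c 0)) {0..1}"
    unfolding v_def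
    by (rule fundamental_theorem_of_calculus_strong[OF S(1)])
       (use S cont in \<open>auto simp: C1_differentiable_on_eq vector_derivative_works\<close>)
  have sv: "s t = v t" if "t \<in> {0..1} - S" for t using that by (simp add: s_def)
  have ftcs: "(s has_integral (c 1 - c 0)) {0..1}"
    by (rule has_integral_spike[OF negligible_finite[OF S(1)] _ ftc]) (simp add: sv)
  have "continuous_on ({0..1} - S) v"
    using S(2) unfolding C1_differentiable_on_eq v_def by blast
  then have "(\<lambda>t. indicator ({0..1} - S) t *\<^sub>R v t) \<in> borel_measurable borel"
    by (intro borel_measurable_continuous_on_indicator) (use S(1) in \<open>auto simp: borel_closed finite_imp_closed\<close>)
  moreover have s_eq: "s = (\<lambda>t. indicator ({0..1} - S) t *\<^sub>R v t)"
    by (auto simp: s_def indicator_def)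
  ultimately have meas: "s \<in> borel_measurable lborel" by simp
  have ae: "AE t in lborel. ennreal (norm (vector_derivative c (at t))) * indicator {0..1} t = ennreal (norm (s t))"
  proof -
    have "AE t in lborel. t \<notin> S" using finite_imp_null_set_lborel[OF S(1)] by (rule AE_not_in)
    then show ?thesis by eventually_elim (auto simp: s_def v_def indicator_def)
  qed
  have len: "curve_length c = (\<integral>\<^sup>+ t. ennreal (norm (s t)) \<partial>lborel)"
    unfolding curve_length_def by (rule nn_integral_cong_AE[OF ae])
  then have int: "integrable lborel s"
    using meas False by (auto simp: integrable_iff_bounded top.not_eq_extremum)
  have "(s has_integral (integral\<^sup>L lborel s)) UNIV" by (rule has_integral_integral_lborel[OF int])
  moreover have "(s has_integral (c 1 - c 0)) UNIV"
    using ftcs by (rule has_integral_on_superset) (auto simp: s_def)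
  ultimately have "c 1 - c 0 = integral\<^sup>L lborel s" by (rule has_integral_unique[rotated])
  then have "ennreal (norm (c 1 - c 0)) \<le> (\<integral>\<^sup>+ t. ennreal (norm (s t)) \<partial>lborel)"
    using integral_norm_bound_ennreal[OF int] by simp
  then show ?thesis unfolding len by (simp add: pathfinish_def pathstart_def)
qed simp

text \<open>No hypothesis on \<open>M\<close> is made: if no curve joins the points, the infimum is
  infinite. Thus a bound on \<open>riem_dist\<close> after the manifold update bounds the norm at
  once.\<close>

lemma norm_le_riem_dist: "ennreal (norm (a - b)) \<le> riem_dist M a b"
  unfolding riem_dist_def
  by (rule INF_greatest) (use norm_le_curve_length in \<open>fastforce simp: norm_minus_commute\<close>)

section \<open>Straightening charts of a C2 submanifold\<close>

text \<open>The straightening map is \<open>\<Psi> z = z - x + B (\<Phi> z - A (z - x))\<close> with \<open>A\<close> the derivative of the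
  defining map \<open>\<Phi>\<close> at \<open>x\<close> and \<open>B\<close> a linear right inverse of \<open>A\<close>: then \<open>A \<circ> \<Psi> = \<Phi>\<close>, so that \<open>\<Psi>\<close>
  maps the zero set of \<open>\<Phi>\<close> into \<open>K = ker A\<close>, and the derivative of \<open>\<Psi>\<close> at \<open>x\<close> is the identity.\<close>
lemma C2_submanifold_chart:
  fixes x :: "'a::euclidean_space"
  assumes "C2_submanifold_at p M x"
  obtains K U V \<Psi> \<phi> and \<Psi>' :: "'a \<Rightarrow> 'a \<Rightarrow>\<^sub>L 'a"
  where "subspace K" "open U" "x \<in> U" "open V" "0 \<in> V" "homeomorphism U V \<Psi> \<phi>" "\<Psi> x = 0"
    "\<And>z. z \<in> U \<Longrightarrow> (\<Psi> has_derivative blinfun_apply (\<Psi>' z)) (at z)"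
    "continuous_on U \<Psi>'" "\<Psi>' x = id_blinfun"
    "\<And>z. z \<in> U \<Longrightarrow> z \<in> M \<longleftrightarrow> \<Psi> z \<in> K"
    "\<And>w. w \<in> V \<Longrightarrow> (\<phi> has_derivative inv (blinfun_apply (\<Psi>' (\<phi> w)))) (at w)"
    "\<And>w. w \<in> V \<Longrightarrow> bij (blinfun_apply (\<Psi>' (\<phi> w)))"
proof -
  obtain U W and \<Phi> :: "'a \<Rightarrow> 'a" where U: "open U" "x \<in> U" and W: "subspace W" "\<Phi> ` U \<subseteq> W"
    and C2: "C2_on U \<Phi>" and range: "range (frechet_derivative \<Phi> (at x)) = W"
    and M: "\<And>z. z \<in> U \<Longrightarrow> z \<in> M \<longleftrightarrow> \<Phi> z = 0" and "x \<in> M"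
    using assms unfolding C2_submanifold_at_def by metis
  obtain \<Phi>' :: "'a \<Rightarrow> 'a \<Rightarrow>\<^sub>L 'a" and \<Phi>'' where
    d: "\<And>z. z \<in> U \<Longrightarrow> (\<Phi> has_derivative blinfun_apply (\<Phi>' z)) (at z)"
    and d2: "\<And>z. z \<in> U \<Longrightarrow> (\<Phi>' has_derivative blinfun_apply (\<Phi>'' z)) (at z)"
    using C2 unfolding C2_on_def by metis
  have cont: "continuous_on U \<Phi>'"
    using d2 by (meson continuous_at_imp_continuous_on has_derivative_continuous)
  define A where "A = \<Phi>' x"
  have rA: "range (blinfun_apply A) = W"
    using range frechet_derivative_at[OF d[OF U(2)]] by (simp add: A_def)
  obtain B where B: "linear B" "\<And>w. w \<in> W \<Longrightarrow> A (B w) = w"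
    using linear_exists_right_inverse_on[of "blinfun_apply A" UNIV] rA
    by (metis blinfun.bounded_linear_right bounded_linear.linear subspace_UNIV)
  define Bb where "Bb = Blinfun B"
  have Bb: "blinfun_apply Bb = B"
    unfolding Bb_def using B(1) by (simp add: bounded_linear_Blinfun_apply linear_conv_bounded_linear)
  define \<Psi> where "\<Psi> z = z - x + B (\<Phi> z - A (z - x))" for z
  define \<Psi>' where "\<Psi>' z = id_blinfun + (Bb o\<^sub>L (\<Phi>' z - A))" for z
  have "\<Phi> x = 0" using M[OF U(2)] \<open>x \<in> M\<close> by simp
  then have \<Psi>0: "\<Psi> x = 0" by (simp add: \<Psi>_def linear_0[OF B(1)])
  have d\<Psi>: "(\<Psi> has_derivative blinfun_apply (\<Psi>' z)) (at z)" if "z \<in> U" for z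
    unfolding \<Psi>_def \<Psi>'_def Bb[symmetric]
    by (rule has_derivative_eq_rhs, (rule derivative_intros d[OF that])+)
       (simp add: blinfun.bilinear_simps fun_eq_iff)
  have c\<Psi>: "continuous_on U \<Psi>'"
    unfolding \<Psi>'_def by (intro continuous_intros cont)
  have \<Psi>'x: "\<Psi>' x = id_blinfun"
    unfolding \<Psi>'_def A_def by (simp add: blinfun_eqI blinfun.bilinear_simps)
  define K where "K = {v. A v = 0}"
  have K: "subspace K"
    unfolding K_def by (simp add: subspace_def blinfun.bilinear_simps)
  have A\<Psi>: "A (\<Psi> z) = \<Phi> z" if "z \<in> U" for z
  proof -
    \<comment> \<open>\<open>B\<close> inverts \<open>A\<close> only on \<open>W\<close>, so the
      argument of \<open>B\<close> has to lie there.\<close>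
    have "\<Phi> z - A (z - x) \<in> W"
      using W that rA by (intro subspace_diff) auto
    then show ?thesis unfolding \<Psi>_def by (simp add: blinfun.add_right B(2))
  qed
  have MK: "z \<in> M \<longleftrightarrow> \<Psi> z \<in> K" if "z \<in> U" for z
    using M[OF that] A\<Psi>[OF that] by (simp add: K_def)
  obtain U' V \<phi> \<phi>' where "open U'" "U' \<subseteq> U" "x \<in> U'" "open V" "\<Psi> x \<in> V" "homeomorphism U' V \<Psi> \<phi>"
    and \<phi>: "\<And>y. y \<in> V \<Longrightarrow> (\<phi> has_derivative (\<phi>' y)) (at y)"
    and \<phi>': "\<And>y. y \<in> V \<Longrightarrow> \<phi>' y = inv (blinfun_apply (\<Psi>' (\<phi> y)))"
    and bij: "\<And>y. y \<in> V \<Longrightarrow> bij (blinfun_apply (\<Psi>' (\<phi> y)))"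
    by (rule inverse_function_theorem[of U \<Psi> \<Psi>' x id_blinfun])
       (use U d\<Psi> c\<Psi> \<Psi>'x in \<open>auto simp: blinfun_eqI\<close>)
  show thesis
  proof (rule that[of K U' V \<Psi> \<phi> \<Psi>'])
    show "0 \<in> V" using \<open>\<Psi> x \<in> V\<close> \<Psi>0 by simp
    show "continuous_on U' \<Psi>'" using continuous_on_subset[OF c\<Psi> \<open>U' \<subseteq> U\<close>] .
    show "(\<Psi> has_derivative blinfun_apply (\<Psi>' z)) (at z)" "z \<in> M \<longleftrightarrow> \<Psi> z \<in> K" if "z \<in> U'" for z
      using that \<open>U' \<subseteq> U\<close> d\<Psi> MK by blast+
    show "(\<phi> has_derivative inv (blinfun_apply (\<Psi>' (\<phi> w)))) (at w)" if "w \<in> V" for w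
      using \<phi>[OF that] \<phi>'[OF that] by simp
  qed fact+
qed

text \<open>This is the mean value inequality for \<open>\<Psi> - id\<close>: coordinate differences
  agree with true differences up to the relative error \<open>\<eta>\<close>.\<close>

lemma near_identity_diff_bound:
  fixes \<Psi> :: "'a::real_normed_vector \<Rightarrow> 'a" and \<Psi>' :: "'a \<Rightarrow> 'a \<Rightarrow>\<^sub>L 'a"
  assumes "convex S" "\<And>z. z \<in> S \<Longrightarrow> (\<Psi> has_derivative blinfun_apply (\<Psi>' z)) (at z)"
    and "\<And>z. z \<in> S \<Longrightarrow> norm (\<Psi>' z - id_blinfun) \<le> \<eta>" "a \<in> S" "b \<in> S"
  shows "norm (\<Psi> a - \<Psi> b - (a - b)) \<le> \<eta> * norm (a - b)"
proof -
  have "norm ((\<Psi> a - a) - (\<Psi> b - b)) \<le> \<eta> * norm (a - b)"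
  proof (rule differentiable_bound[OF assms(1) _ _ assms(4,5)])
    fix z assume z: "z \<in> S"
    show "((\<lambda>z. \<Psi> z - z) has_derivative blinfun_apply (\<Psi>' z - id_blinfun)) (at z within S)"
      by (rule has_derivative_at_withinI, rule has_derivative_eq_rhs,
          (rule derivative_intros assms(2)[OF z])+)
         (simp add: blinfun.bilinear_simps fun_eq_iff)
    show "onorm (blinfun_apply (\<Psi>' z - id_blinfun)) \<le> \<eta>"
      using assms(3)[OF z] by (simp add: norm_blinfun.rep_eq)
  qed
  then show ?thesis by (simp add: algebra_simps)
qed


text \<open>The chart is shrunk to balls on both sides. Convexity of the ball around
  \<open>x\<close> admits the mean value inequality; in the ball around 0, segments to the origin
  and orthogonal projections onto \<open>K\<close> stay in the domain of
  \<open>\<phi>\<close>.\<close>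

lemma C2_submanifold_near_identity_chart:
  fixes x :: "'a::euclidean_space"
  assumes "C2_submanifold_at p M x" "\<eta> > 0"
  obtains K \<rho> \<sigma> \<Psi> and \<Psi>' :: "'a \<Rightarrow> 'a \<Rightarrow>\<^sub>L 'a" and \<phi>
  where "subspace K" "\<rho> > 0" "\<sigma> > 0" "\<Psi> x = 0"
    "\<And>z. z \<in> ball x \<rho> \<Longrightarrow> (\<Psi> has_derivative blinfun_apply (\<Psi>' z)) (at z)"
    "continuous_on (ball x \<rho>) \<Psi>'" "\<Psi>' x = id_blinfun"
    "\<And>z. z \<in> ball x \<rho> \<Longrightarrow> norm (\<Psi>' z - id_blinfun) \<le> \<eta>"
    "\<And>z. z \<in> ball x \<rho> \<Longrightarrow> z \<in> M \<longleftrightarrow> \<Psi> z \<in> K"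
    "\<And>z. z \<in> ball x \<rho> \<Longrightarrow> \<phi> (\<Psi> z) = z"
    "\<And>w. w \<in> ball 0 \<sigma> \<Longrightarrow> \<phi> w \<in> ball x \<rho> \<and> \<Psi> (\<phi> w) = w"
    "\<And>w. w \<in> ball 0 \<sigma> \<Longrightarrow> (\<phi> has_derivative inv (blinfun_apply (\<Psi>' (\<phi> w)))) (at w)"
    "\<And>w. w \<in> ball 0 \<sigma> \<Longrightarrow> bij (blinfun_apply (\<Psi>' (\<phi> w)))"
proof -
  obtain K U V \<Psi> \<phi> and \<Psi>' :: "'a \<Rightarrow> 'a \<Rightarrow>\<^sub>L 'a"
  where c: "subspace K" "open U" "x \<in> U" "open V" "0 \<in> V" "homeomorphism U V \<Psi> \<phi>" "\<Psi> x = 0"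
    "\<And>z. z \<in> U \<Longrightarrow> (\<Psi> has_derivative blinfun_apply (\<Psi>' z)) (at z)"
    "continuous_on U \<Psi>'" "\<Psi>' x = id_blinfun"
    "\<And>z. z \<in> U \<Longrightarrow> z \<in> M \<longleftrightarrow> \<Psi> z \<in> K"
    "\<And>w. w \<in> V \<Longrightarrow> (\<phi> has_derivative inv (blinfun_apply (\<Psi>' (\<phi> w)))) (at w)"
    "\<And>w. w \<in> V \<Longrightarrow> bij (blinfun_apply (\<Psi>' (\<phi> w)))"
    by (fact C2_submanifold_chart[OF assms(1)])
  have "\<forall>\<^sub>F z in at x. dist (\<Psi>' z) (\<Psi>' x) < \<eta>"
    using c(2,3,9) assms(2) by (intro tendstoD) (auto simp: continuous_on_eq_continuous_at isCont_def)
  then obtain \<rho>1 where \<rho>1: "\<rho>1 > 0" "\<And>z. dist z x < \<rho>1 \<Longrightarrow> norm (\<Psi>' z - id_blinfun) \<le> \<eta>"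
    unfolding eventually_at using c(10) assms(2)
    by (metis UNIV_I dist_norm less_eq_real_def norm_zero diff_self)
  obtain \<rho>2 where \<rho>2: "\<rho>2 > 0" "ball x \<rho>2 \<subseteq> U"
    using c(2,3) open_contains_ball by blast
  define \<rho> where "\<rho> = min \<rho>1 \<rho>2"
  have \<rho>: "\<rho> > 0" "ball x \<rho> \<subseteq> U" "\<And>z. z \<in> ball x \<rho> \<Longrightarrow> norm (\<Psi>' z - id_blinfun) \<le> \<eta>"
    using \<rho>1 \<rho>2 by (auto simp: \<rho>_def dist_commute)
  have "\<phi> 0 = x" using homeomorphism_apply1[OF c(6,3)] c(7) by simp
  moreover have "isCont \<phi> 0" using c(12)[OF c(5)] has_derivative_continuous by blast
  ultimately obtain \<sigma>1 where \<sigma>1: "\<sigma>1 > 0" "\<And>w. norm w < \<sigma>1 \<Longrightarrow> dist (\<phi> w) x < \<rho>"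
    using \<rho>(1) unfolding continuous_at_eps_delta by (metis diff_zero dist_norm)
  obtain \<sigma>2 where \<sigma>2: "\<sigma>2 > 0" "ball 0 \<sigma>2 \<subseteq> V"
    using c(4,5) open_contains_ball by blast
  define \<sigma> where "\<sigma> = min \<sigma>1 \<sigma>2"
  have \<sigma>: "\<sigma> > 0" using \<sigma>1(1) \<sigma>2(1) by (simp add: \<sigma>_def)
  have V: "w \<in> V \<and> \<phi> w \<in> ball x \<rho>" if "w \<in> ball 0 \<sigma>" for w
    using \<sigma>1(2)[of w] \<sigma>2(2) that by (auto simp: \<sigma>_def dist_commute)
  have inv1: "\<phi> (\<Psi> z) = z" if "z \<in> U" for z using homeomorphism_apply1[OF c(6) that] .
  have inv2: "\<Psi> (\<phi> w) = w" if "w \<in> V" for w using homeomorphism_apply2[OF c(6) that] .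
  have U: "z \<in> U" if "z \<in> ball x \<rho>" for z using \<rho>(2) that by blast
  show thesis
  proof (rule that[of K \<rho> \<sigma> \<Psi> \<Psi>' \<phi>, OF c(1) \<rho>(1) \<sigma> c(7) c(8)[OF U] _ c(10) \<rho>(3) c(11)[OF U] inv1[OF U]])
    show "continuous_on (ball x \<rho>) \<Psi>'" using continuous_on_subset[OF c(9) \<rho>(2)] .
    show "\<phi> w \<in> ball x \<rho> \<and> \<Psi> (\<phi> w) = w"
      "(\<phi> has_derivative inv (blinfun_apply (\<Psi>' (\<phi> w)))) (at w)"
      "bij (blinfun_apply (\<Psi>' (\<phi> w)))" if "w \<in> ball 0 \<sigma>" for w
      using V[OF that] inv2 c(12,13) by blast+
  qed
qed

section \<open>Approximate normals and a local bound on the Riemannian distance\<close>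

text \<open>Along a curve \<open>c\<close> in \<open>M\<close> the points
  \<open>\<Psi> (c t)\<close> lie in \<open>K\<close>, so \<open>n \<bullet> \<Psi> (c t)\<close>
  vanishes near 0; its derivative there is \<open>n \<bullet> v\<close>, as \<open>\<Psi>\<close>
  has derivative \<open>id\<close>. Hence vectors orthogonal to \<open>K\<close> are normal to
  \<open>M\<close>.\<close>

lemma tangent_space_orthogonal:
  fixes x :: "'a::euclidean_space"
  assumes "v \<in> tangent_space M x" "\<rho> > 0" "n \<in> K\<^sup>\<bottom>"
    and \<Psi>: "(\<Psi> has_derivative id) (at x)"
    and MK: "\<And>z. z \<in> ball x \<rho> \<Longrightarrow> z \<in> M \<longleftrightarrow> \<Psi> z \<in> K"
  shows "n \<bullet> v = 0"
proof -
  obtain c e where c: "e > 0" "c ` {-e<..<e} \<subseteq> M" "c 0 = x" "(c has_vector_derivative v) (at 0)"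
    using assms(1) unfolding tangent_space_def by blast
  have "(\<Psi> \<circ> c has_derivative id \<circ> (\<lambda>h. h *\<^sub>R v)) (at 0)"
    using c(3,4) \<Psi> by (intro diff_chain_at) (auto simp: has_vector_derivative_def)
  then have "((\<lambda>t. n \<bullet> \<Psi> (c t)) has_derivative (\<lambda>h. n \<bullet> (h *\<^sub>R v))) (at 0)"
    by (auto intro!: derivative_eq_intros simp: o_def)
  moreover have "isCont c 0" using c(4) has_vector_derivative_continuous by blast
  then have "\<forall>\<^sub>F t in at 0. c t \<in> ball x \<rho>"
    using c(3) assms(2) by (auto simp: isCont_def dist_commute dest: tendstoD)
  then have "\<forall>\<^sub>F t in at 0. n \<bullet> \<Psi> (c t) = 0"
  proof -
    have "\<forall>\<^sub>F t in at (0::real). t \<in> {-e<..<e}"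
      using c(1) by (intro eventually_at_in_open') auto
    with \<open>\<forall>\<^sub>F t in at 0. c t \<in> ball x \<rho>\<close> show ?thesis
    proof eventually_elim
      case (elim t)
      then have "\<Psi> (c t) \<in> K" using MK c(2) by blast
      then show ?case using assms(3) unfolding orthogonal_comp_def orthogonal_def by (auto simp: inner_commute)
    qed
  qed
  moreover have "n \<bullet> \<Psi> (c 0) = 0"
  proof -
    have "x \<in> M" using c(1-3) by force
    then have "\<Psi> x \<in> K" using MK[of x] assms(2) by simp
    then show ?thesis using assms(3) c(3) unfolding orthogonal_comp_def orthogonal_def by (auto simp: inner_commute)
  qed
  ultimately have "((\<lambda>t. 0::real) has_derivative (\<lambda>h. n \<bullet> (h *\<^sub>R v))) (at 0)"
    by (rule has_derivative_transform_eventually) auto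
  then have "(\<lambda>h. n \<bullet> (h *\<^sub>R v)) = (\<lambda>h. 0)"
    using has_derivative_const[of "0::real" "at 0"] has_derivative_unique by blast
  then show ?thesis by (metis scaleR_one)
qed

text \<open>With \<open>k\<close> the orthogonal projection of \<open>\<Psi> x\<close> onto
  \<open>K\<close>, the point \<open>z = \<phi> k\<close> lies on \<open>M\<close> and
  \<open>\<Psi> x - \<Psi> z\<close> is exactly normal; the near-identity bound transfers this to
  \<open>x - z\<close>. One parameter \<open>\<eta>\<close> gives both the radius and the relative
  error, so that it can later be sent to 0.\<close>

lemma approx_normal_projection:
  fixes x0 :: "'a::euclidean_space"
  assumes "C2_submanifold_at p M x0" "\<eta> > 0"
  obtains \<delta> where "\<delta> > 0"
    "\<And>x. x \<in> ball x0 \<delta> \<Longrightarrow> \<exists>z\<in>M \<inter> ball x0 \<eta>. \<exists>n\<in>normal_space M x0. norm (x - z - n) \<le> \<eta> * norm (x - z)"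
proof -
  obtain K \<rho> \<sigma> \<Psi> and \<Psi>' :: "'a \<Rightarrow> 'a \<Rightarrow>\<^sub>L 'a" and \<phi>
  where c: "subspace K" "\<rho> > 0" "\<sigma> > 0" "\<Psi> x0 = 0"
    "\<And>z. z \<in> ball x0 \<rho> \<Longrightarrow> (\<Psi> has_derivative blinfun_apply (\<Psi>' z)) (at z)"
    "continuous_on (ball x0 \<rho>) \<Psi>'" "\<Psi>' x0 = id_blinfun"
    "\<And>z. z \<in> ball x0 \<rho> \<Longrightarrow> norm (\<Psi>' z - id_blinfun) \<le> \<eta>"
    "\<And>z. z \<in> ball x0 \<rho> \<Longrightarrow> z \<in> M \<longleftrightarrow> \<Psi> z \<in> K"
    "\<And>z. z \<in> ball x0 \<rho> \<Longrightarrow> \<phi> (\<Psi> z) = z"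
    "\<And>w. w \<in> ball 0 \<sigma> \<Longrightarrow> \<phi> w \<in> ball x0 \<rho> \<and> \<Psi> (\<phi> w) = w"
    "\<And>w. w \<in> ball 0 \<sigma> \<Longrightarrow> (\<phi> has_derivative inv (blinfun_apply (\<Psi>' (\<phi> w)))) (at w)"
    "\<And>w. w \<in> ball 0 \<sigma> \<Longrightarrow> bij (blinfun_apply (\<Psi>' (\<phi> w)))"
    by (fact C2_submanifold_near_identity_chart[OF assms])
  have id: "(\<Psi> has_derivative id) (at x0)"
    using c(5)[of x0] c(2,7) by (simp add: id_def)
  have "isCont \<phi> 0" using has_derivative_continuous[OF c(12)] c(3) by simp
  moreover have "\<phi> 0 = x0" using c(10)[of x0] c(2,4) by simp
  ultimately have "\<exists>\<tau>>0. \<forall>w. dist w 0 < \<tau> \<longrightarrow> dist (\<phi> w) x0 < \<eta>"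
    using assms(2) unfolding continuous_at_eps_delta by auto
  then obtain \<tau> where \<tau>: "\<tau> > 0" "\<And>w. norm w < \<tau> \<Longrightarrow> dist (\<phi> w) x0 < \<eta>"
    by auto
  have "isCont \<Psi> x0" using id has_derivative_continuous by blast
  moreover have "0 < min \<sigma> \<tau>" using c(3) \<tau>(1) by simp
  ultimately have "\<exists>\<delta>>0. \<forall>x. dist x x0 < \<delta> \<longrightarrow> dist (\<Psi> x) (\<Psi> x0) < min \<sigma> \<tau>"
    unfolding continuous_at_eps_delta by blast
  then obtain \<delta> where \<delta>: "\<delta> > 0" "\<And>x. dist x x0 < \<delta> \<Longrightarrow> norm (\<Psi> x) < min \<sigma> \<tau>"
    using c(4) by (auto simp del: min_less_iff_conj)
  show thesis
  proof (rule that[of "min \<delta> \<rho>"])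
    fix x assume x: "x \<in> ball x0 (min \<delta> \<rho>)"
    obtain k n where kn: "k \<in> K" "n \<in> K\<^sup>\<bottom>" "\<Psi> x = k + n"
    proof -
      have "\<Psi> x \<in> K + K\<^sup>\<bottom>" using subspace_sum_orthogonal_comp[OF c(1)] by simp
      then show thesis using that by (auto elim: set_plus_elim)
    qed
    \<comment> \<open>By Pythagoras \<open>k\<close> is no longer than \<open>\<Psi> x\<close>, so
      the choice of \<open>\<delta>\<close> keeps \<open>k\<close> in the domain of
      \<open>\<phi>\<close> and \<open>\<phi> k\<close> within \<open>\<eta>\<close> of
      \<open>x0\<close>.\<close>
    have "orthogonal k n" using kn(1,2) unfolding orthogonal_comp_def by blast
    then have "(norm (\<Psi> x))\<^sup>2 = (norm k)\<^sup>2 + (norm n)\<^sup>2"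
      unfolding kn(3) by (rule norm_add_Pythagorean)
    then have "norm k \<le> norm (\<Psi> x)" by (auto intro!: power2_le_imp_le[of "norm k" "norm (\<Psi> x)"])
    then have k: "norm k < \<sigma>" "norm k < \<tau>" using \<delta>(2)[of x] x by (auto simp: dist_commute)
    then have z: "\<phi> k \<in> ball x0 \<rho>" "\<Psi> (\<phi> k) = k" using c(11)[of k] by auto
    have "norm (\<Psi> x - \<Psi> (\<phi> k) - (x - \<phi> k)) \<le> \<eta> * norm (x - \<phi> k)"
      by (rule near_identity_diff_bound[OF convex_ball c(5,8) _ z(1)]) (use x in auto)
    then have "norm (x - \<phi> k - n) \<le> \<eta> * norm (x - \<phi> k)"
      using z(2) kn(3) by (metis add_diff_cancel_left' norm_minus_commute)
    moreover have "n \<in> normal_space M x0"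
      unfolding normal_space_def orthogonal_comp_def orthogonal_def
      by (intro CollectI ballI, subst inner_commute)
         (rule tangent_space_orthogonal[OF _ c(2) kn(2) id c(9)])
    moreover have "\<phi> k \<in> M \<inter> ball x0 \<eta>"
      using c(9)[OF z(1)] z(2) kn(1) \<tau>(2)[OF k(2)] by (auto simp: dist_commute)
    ultimately show "\<exists>z\<in>M \<inter> ball x0 \<eta>. \<exists>n\<in>normal_space M x0. norm (x - z - n) \<le> \<eta> * norm (x - z)"
      by blast
  qed (use \<delta> c(2) in auto)
qed

text \<open>The segment from \<open>\<Psi> a\<close> to 0 stays in \<open>K\<close>, and
  \<open>\<phi>\<close> carries it to a curve in \<open>M\<close>. With tolerance 1/2 its speed is
  at most \<open>2 |\<Psi> a|\<close> and \<open>|\<Psi> a|\<close> is at most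
  \<open>3/2 |a - x|\<close>, whence the factor 3.\<close>

lemma riem_dist_le_norm_near:
  fixes x :: "'a::euclidean_space"
  assumes "C2_submanifold_at p M x"
  obtains \<delta> where "\<delta> > 0"
    "\<And>a. a \<in> M \<inter> ball x \<delta> \<Longrightarrow> riem_dist M a x \<le> ennreal (3 * norm (a - x))"
proof -
  obtain K \<rho> \<sigma> \<Psi> and \<Psi>' :: "'a \<Rightarrow> 'a \<Rightarrow>\<^sub>L 'a" and \<phi>
  where c: "subspace K" "\<rho> > 0" "\<sigma> > 0" "\<Psi> x = 0"
    "\<And>z. z \<in> ball x \<rho> \<Longrightarrow> (\<Psi> has_derivative blinfun_apply (\<Psi>' z)) (at z)"
    "continuous_on (ball x \<rho>) \<Psi>'" "\<Psi>' x = id_blinfun"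
    "\<And>z. z \<in> ball x \<rho> \<Longrightarrow> norm (\<Psi>' z - id_blinfun) \<le> 1 / 2"
    "\<And>z. z \<in> ball x \<rho> \<Longrightarrow> z \<in> M \<longleftrightarrow> \<Psi> z \<in> K"
    "\<And>z. z \<in> ball x \<rho> \<Longrightarrow> \<phi> (\<Psi> z) = z"
    "\<And>w. w \<in> ball 0 \<sigma> \<Longrightarrow> \<phi> w \<in> ball x \<rho> \<and> \<Psi> (\<phi> w) = w"
    "\<And>w. w \<in> ball 0 \<sigma> \<Longrightarrow> (\<phi> has_derivative inv (blinfun_apply (\<Psi>' (\<phi> w)))) (at w)"
    "\<And>w. w \<in> ball 0 \<sigma> \<Longrightarrow> bij (blinfun_apply (\<Psi>' (\<phi> w)))"
    by (fact C2_submanifold_near_identity_chart[OF assms half_gt_zero[OF zero_less_one]])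
  have bound: "norm (\<Psi> a) \<le> 3 / 2 * norm (a - x)" if "a \<in> ball x \<rho>" for a
  proof -
    have "norm (\<Psi> a - \<Psi> x - (a - x)) \<le> 1 / 2 * norm (a - x)"
      by (rule near_identity_diff_bound[OF convex_ball c(5,8) that]) (use c(2) in auto)
    then show ?thesis using c(4) norm_triangle_ineq2[of "\<Psi> a" "a - x"] by simp
  qed
  have expand: "norm h \<le> 2 * norm (\<Psi>' z h)" if "z \<in> ball x \<rho>" for z h
  proof -
    have "norm ((\<Psi>' z - id_blinfun) h) \<le> 1 / 2 * norm h"
      by (rule order_trans[OF norm_blinfun mult_right_mono[OF c(8)[OF that]]]) simp
    then show ?thesis
      using norm_triangle_ineq2[of h "\<Psi>' z h"] by (simp add: blinfun.diff_left norm_minus_commute)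
  qed
  show thesis
  \<comment> \<open>Half of \<open>\<sigma>\<close> absorbs the factor 3/2, so that
    \<open>\<Psi> a\<close> has norm below \<open>\<sigma>\<close>.\<close>
  proof (rule that[of "min \<rho> (\<sigma> / 2)"])
    fix a assume a: "a \<in> M \<inter> ball x (min \<rho> (\<sigma> / 2))"
    define u where "u = \<Psi> a"
    \<comment> \<open>The parameter \<open>1 - t\<close> starts the curve at \<open>a\<close> and
      ends it at \<open>x\<close>; its velocity is \<open>- q t\<close>.\<close>
    define c' where "c' t = \<phi> ((1 - t) *\<^sub>R u)" for t
    define q where "q t = inv (blinfun_apply (\<Psi>' (c' t))) u" for t
    have u: "u \<in> K" "norm u \<le> 3 / 2 * norm (a - x)" "norm u < \<sigma>"
      using c(9)[of a] bound[of a] c(3) a unfolding u_def by (auto simp: dist_norm norm_minus_commute)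
    have in_ball: "(1 - t) *\<^sub>R u \<in> ball 0 \<sigma>" if "t \<in> {0..1}" for t
    proof -
      have "norm ((1 - t) *\<^sub>R u) \<le> 1 * norm u" unfolding norm_scaleR using that by (intro mult_right_mono) auto
      then show ?thesis using u(3) by simp
    qed
    have c'_ball: "c' t \<in> ball x \<rho>" if "t \<in> {0..1}" for t
      using c(11)[OF in_ball[OF that]] by (simp add: c'_def)
    have \<Psi>q: "\<Psi>' (c' t) (q t) = u" if "t \<in> {0..1}" for t
      using c(13)[OF in_ball[OF that]] unfolding q_def c'_def by (simp add: bij_is_surj surj_f_inv_f)
    have q_le: "norm (q t) \<le> 2 * norm u" if "t \<in> {0..1}" for t
      using expand[OF c'_ball[OF that], of "q t"] \<Psi>q[OF that] by simp
    have der: "(c' has_vector_derivative - q t) (at t)" if "t \<in> {0..1}" for t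
    proof -
      have "((\<lambda>t. (1 - t) *\<^sub>R u) has_derivative (\<lambda>h. h *\<^sub>R (- u))) (at t)"
        by (auto intro!: derivative_eq_intros)
      from has_derivative_compose[OF this c(12)[OF in_ball[OF that]]]
      have "(c' has_derivative (\<lambda>h. inv (blinfun_apply (\<Psi>' (c' t))) (h *\<^sub>R (- u)))) (at t)"
        unfolding c'_def .
      moreover have "linear (inv (blinfun_apply (\<Psi>' (c' t))))"
        using c(12)[OF in_ball[OF that]] has_derivative_linear unfolding c'_def by blast
      ultimately show ?thesis
        unfolding has_vector_derivative_def q_def by (simp add: linear_scale linear_neg)
    qed
    have contc: "continuous_on {0..1} c'"
      by (intro continuous_at_imp_continuous_on ballI has_vector_derivative_continuous[OF der])
    have cont\<Psi>: "continuous_on {0..1} (\<lambda>t. \<Psi>' (c' t))"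
      by (rule continuous_on_compose2[OF c(6) contc]) (use c'_ball in blast)
    have contq: "continuous_on {0..1} q"
      unfolding continuous_on_def
    proof
      fix s :: real assume s: "s \<in> {0..1}"
      have "((\<lambda>t. \<Psi>' (c' t)) \<longlongrightarrow> \<Psi>' (c' s)) (at s within {0..1})"
        using cont\<Psi> s unfolding continuous_on_def by blast
      then have "((\<lambda>t. 2 * (norm (\<Psi>' (c' s) - \<Psi>' (c' t)) * norm (q s))) \<longlongrightarrow> 2 * (norm (\<Psi>' (c' s) - \<Psi>' (c' s)) * norm (q s))) (at s within {0..1})"
        by (intro tendsto_intros)
      then have lim: "((\<lambda>t. 2 * (norm (\<Psi>' (c' s) - \<Psi>' (c' t)) * norm (q s))) \<longlongrightarrow> 0) (at s within {0..1})"
        by simp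
      \<comment> \<open>Continuity of the inverse derivatives is needed only on the fixed vector
        \<open>u\<close>: both \<open>q t\<close> and \<open>q s\<close> are mapped to
        \<open>u\<close>, each by its own derivative, and \<open>expand\<close> bounds their
        difference by the difference of the derivatives.\<close>
      have "norm (q t - q s) \<le> 2 * (norm (\<Psi>' (c' s) - \<Psi>' (c' t)) * norm (q s))" if t: "t \<in> {0..1}" for t
      proof -
        have "\<Psi>' (c' t) (q t - q s) = (\<Psi>' (c' s) - \<Psi>' (c' t)) (q s)"
          using \<Psi>q[OF t] \<Psi>q[OF s] by (simp add: blinfun.diff_left blinfun.diff_right)
        then show ?thesis using expand[OF c'_ball[OF t], of "q t - q s"]
          norm_blinfun[of "\<Psi>' (c' s) - \<Psi>' (c' t)" "q s"] by simp
      qed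
      then have "((\<lambda>t. q t - q s) \<longlongrightarrow> 0) (at s within {0..1})"
        by (intro Lim_null_comparison[OF _ lim]) (auto simp: eventually_at_filter)
      then show "(q \<longlongrightarrow> q s) (at s within {0..1})" by (rule LIM_zero_cancel)
    qed
    have "c' C1_differentiable_on {0..1}"
      unfolding C1_differentiable_on_def
      by (intro exI[of _ "\<lambda>t. - q t"] conjI ballI der continuous_on_minus contq)
    then have "valid_path c'"
      unfolding valid_path_def by (rule C1_differentiable_imp_piecewise)
    moreover have "path_image c' \<subseteq> M"
    proof -
      have "c' t \<in> M" if "t \<in> {0..1}" for t
        using c(9)[OF c'_ball[OF that]] c(11)[OF in_ball[OF that]] subspace_scale[OF c(1) u(1)]
        by (simp add: c'_def)
      then show ?thesis unfolding path_image_def by blast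
    qed
    moreover have "pathstart c' = a" "pathfinish c' = x"
      using a c(10)[of a] c(10)[of x] c(2,4) by (auto simp: pathstart_def pathfinish_def c'_def u_def)
    ultimately have "riem_dist M a x \<le> curve_length c'"
      unfolding riem_dist_def by (intro INF_lower) simp
    also have "\<dots> \<le> (\<integral>\<^sup>+ t. ennreal (2 * norm u) * indicator {0..1::real} t \<partial>lborel)"
      unfolding curve_length_def
    proof (rule nn_integral_mono)
      fix t :: real
      show "ennreal (norm (vector_derivative c' (at t))) * indicator {0..1} t \<le> ennreal (2 * norm u) * indicator {0..1} t"
        using q_le[of t] vector_derivative_at[OF der, of t] by (auto simp: indicator_def intro!: ennreal_leI)
    qed
    also have "\<dots> = ennreal (2 * norm u)"
      by (subst nn_integral_cmult_indicator) auto
    also have "\<dots> \<le> ennreal (3 * norm (a - x))"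
      using u(2) by (intro ennreal_leI) simp
    finally show "riem_dist M a x \<le> ennreal (3 * norm (a - x))" .
  qed (use c(2,3) in auto)
qed

section \<open>Identification of the active manifold\<close>

text \<open>The argument of Hare and Lewis: if \<open>X n\<close> stays outside \<open>M\<close>, let \<open>Z n\<close> be an approximate
  projection onto \<open>M\<close>.  The normalised differences accumulate at a unit normal \<open>d\<close>, and
  \<open>vb + e d\<close> is still a subgradient at \<open>xb\<close>, hence approximated by subgradients at \<open>Z n\<close>.  Adding the
  two prox-regularity inequalities between \<open>X n\<close> and \<open>Z n\<close> yields \<open>e \<le> 0\<close> in the limit.\<close>
lemma partly_smooth_identification:
  fixes xb :: "'a::euclidean_space"
  assumes reg: "prox_regular r g xb" and ps: "partly_smooth g M xb"
    and vb: "vb \<in> rel_interior (limiting_subdiff g xb)"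
    and X: "X \<longlonglongrightarrow> xb" and V: "\<And>n. V n \<in> limiting_subdiff g (X n)" "V \<longlonglongrightarrow> vb"
    and gX: "\<And>\<epsilon>. \<epsilon> > 0 \<Longrightarrow> \<forall>\<^sub>F n in sequentially. g (X n) < g xb + ereal \<epsilon>"
  shows "\<forall>\<^sub>F n in sequentially. X n \<in> M"
proof (rule ccontr)
  assume "\<not> ?thesis"
  then have freq: "\<exists>\<^sub>F n in sequentially. X n \<notin> M" by (simp add: frequently_def)
  define N where "N = normal_space M xb"
  have N: "subspace N" unfolding N_def normal_space_def by (rule subspace_orthogonal_comp)
  obtain p where sub: "C2_submanifold_at p M xb" using ps unfolding partly_smooth_def by blast
  \<comment> \<open>The radius \<open>\<delta>\<close> depends on the tolerance
    \<open>1/(n + 1)\<close>, so the index \<open>m\<close> is chosen after it;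
    \<open>n \<le> m\<close> makes the chosen indices tend to infinity.\<close>
  have "\<exists>m z v. n \<le> m \<and> X m \<notin> M \<and> z \<in> M \<and> dist xb z < inverse (Suc n) \<and> v \<in> N
      \<and> norm (X m - z - v) \<le> inverse (Suc n) * norm (X m - z)" for n :: nat
  proof -
    have pos: "0 < inverse (real (Suc n))" by simp
    obtain \<delta> where \<delta>: "\<delta> > 0" "\<And>x. x \<in> ball xb \<delta> \<Longrightarrow> \<exists>z\<in>M \<inter> ball xb (inverse (Suc n)).
        \<exists>v\<in>normal_space M xb. norm (x - z - v) \<le> inverse (Suc n) * norm (x - z)"
      by (fact approx_normal_projection[OF sub pos])
    have "\<forall>\<^sub>F m in sequentially. X m \<in> ball xb \<delta> \<and> n \<le> m"
      using tendstoD[OF X \<delta>(1)] eventually_ge_at_top[of n]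
      by eventually_elim (simp add: dist_commute)
    from frequently_eventually_conj[OF freq this]
    obtain m where "X m \<notin> M" "X m \<in> ball xb \<delta>" "n \<le> m"
      by (auto dest!: frequently_ex)
    moreover from this \<delta>(2) obtain z v where "z \<in> M" "z \<in> ball xb (inverse (Suc n))" "v \<in> normal_space M xb"
      "norm (X m - z - v) \<le> inverse (Suc n) * norm (X m - z)" by blast
    ultimately show ?thesis unfolding N_def mem_ball by blast
  qed
  then obtain m Z v where m: "\<And>n::nat. n \<le> m n" and XM: "\<And>n. X (m n) \<notin> M" and ZM: "\<And>n. Z n \<in> M"
    and Zd: "\<And>n. dist xb (Z n) < inverse (Suc n)" and v: "\<And>n. v n \<in> N"
    and vd: "\<And>n. norm (X (m n) - Z n - v n) \<le> inverse (Suc n) * norm (X (m n) - Z n)"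
    by metis
  define D where "D n = (X (m n) - Z n) /\<^sub>R norm (X (m n) - Z n)" for n
  have ne: "norm (X (m n) - Z n) > 0" for n using XM[of n] ZM[of n] by auto
  have "D n \<in> sphere 0 1" for n using ne[of n] by (simp add: D_def)
  then obtain d k where d: "d \<in> sphere 0 1" and k: "strict_mono (k :: nat \<Rightarrow> nat)" "(D \<circ> k) \<longlonglongrightarrow> d"
    using compact_sphere[of "0::'a" 1] unfolding compact_def by blast
  have klim: "filterlim k at_top sequentially" using k(1) by (rule filterlim_subseq)
  have mk: "filterlim (\<lambda>n. m (k n)) at_top sequentially"
    by (rule filterlim_at_top_mono[OF klim]) (simp add: m)
  have inv0: "(\<lambda>n. inverse (real (Suc n))) \<longlonglongrightarrow> 0" by (rule LIMSEQ_inverse_real_of_nat)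
  have "(\<lambda>n. Z n - xb) \<longlonglongrightarrow> 0"
    by (rule Lim_null_comparison[OF _ inv0])
       (use Zd in \<open>auto simp: dist_norm norm_minus_commute less_imp_le simp del: of_nat_Suc\<close>)
  then have "Z \<longlonglongrightarrow> xb" by (rule LIM_zero_cancel)
  then have Zk: "(\<lambda>n. Z (k n)) \<longlonglongrightarrow> xb" using klim by (rule filterlim_compose)
  have Xk: "(\<lambda>n. X (m (k n))) \<longlonglongrightarrow> xb" using X mk by (rule filterlim_compose)
  have Vk: "(\<lambda>n. V (m (k n))) \<longlonglongrightarrow> vb" using V(2) mk by (rule filterlim_compose)
  \<comment> \<open>\<open>D n\<close> is within \<open>1/(n + 1)\<close> of an element of
    \<open>N\<close>, and the subspace \<open>N\<close> is closed.\<close>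
  have dN: "d \<in> N"
  proof -
    have "norm (D n - v n /\<^sub>R norm (X (m n) - Z n)) \<le> inverse (Suc n)" for n
    proof -
      have "norm (D n - v n /\<^sub>R norm (X (m n) - Z n)) = norm (X (m n) - Z n - v n) / norm (X (m n) - Z n)"
        using ne[of n] unfolding D_def by (simp flip: scaleR_diff_right add: divide_inverse mult.commute)
      then show ?thesis
        using vd[of n] unfolding pos_divide_le_eq[OF ne[of n], symmetric] by simp
    qed
    then have "(\<lambda>n. D n - v n /\<^sub>R norm (X (m n) - Z n)) \<longlonglongrightarrow> 0"
      by (intro Lim_null_comparison[OF _ inv0]) auto
    then have "(\<lambda>n. D (k n) - v (k n) /\<^sub>R norm (X (m (k n)) - Z (k n))) \<longlonglongrightarrow> 0"
      using klim by (rule filterlim_compose)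
    from tendsto_diff[OF k(2)[unfolded o_def] this]
    have "(\<lambda>n. v (k n) /\<^sub>R norm (X (m (k n)) - Z (k n))) \<longlonglongrightarrow> d" by simp
    then show ?thesis
      by (rule closed_sequentially[OF closed_subspace[OF N], rotated]) (simp add: subspace_scale[OF N v])
  qed
  \<comment> \<open>The affine hull of the subdifferential is a translate of \<open>N\<close>, so
    moving from \<open>vb\<close> along \<open>d\<close> stays in it; relative interiority allows a
    step of half the radius.\<close>
  obtain e where e: "e > 0" and v1: "vb + e *\<^sub>R d \<in> limiting_subdiff g xb"
  proof -
    obtain \<epsilon> where \<epsilon>: "\<epsilon> > 0" "ball vb \<epsilon> \<inter> affine hull (limiting_subdiff g xb) \<subseteq> limiting_subdiff g xb"
      and vbS: "vb \<in> limiting_subdiff g xb"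
      using vb unfolding mem_rel_interior_ball by blast
    obtain a where a: "affine hull (limiting_subdiff g xb) = (+) a ` N"
      using ps unfolding partly_smooth_def N_def by blast
    then obtain n1 where n1: "n1 \<in> N" "vb = a + n1" using hull_inc[OF vbS] by force
    have "vb + (\<epsilon> / 2) *\<^sub>R d = a + (n1 + (\<epsilon> / 2) *\<^sub>R d)" by (simp add: n1(2))
    then have "vb + (\<epsilon> / 2) *\<^sub>R d \<in> affine hull (limiting_subdiff g xb)"
      unfolding a using subspace_add[OF N n1(1) subspace_scale[OF N dN]] by blast
    moreover have "vb + (\<epsilon> / 2) *\<^sub>R d \<in> ball vb \<epsilon>" using d \<epsilon>(1) by (simp add: dist_norm)
    ultimately show thesis using \<epsilon> by (intro that[of "\<epsilon> / 2"]) auto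
  qed
  have v0: "vb \<in> limiting_subdiff g xb" using vb rel_interior_subset by blast
  obtain w where wS: "\<forall>\<^sub>F n in sequentially. w n \<in> limiting_subdiff g (Z (k n))" and w: "w \<longlonglongrightarrow> vb + e *\<^sub>R d"
  proof -
    have "setvalued_continuous_within (limiting_subdiff g) M xb"
      using ps unfolding partly_smooth_def by blast
    then show thesis
      unfolding setvalued_continuous_within_def using v1 ZM Zk that by meson
  qed
  \<comment> \<open>Prox-regularity also asks for values of \<open>g\<close> close to
    \<open>g xb\<close>. At the points \<open>Z\<close> this comes from the continuity of
    \<open>h\<close>, which represents \<open>g\<close> on \<open>M\<close>.\<close>
  obtain U h where U: "xb \<in> U" "C2_on U h" and gh: "\<And>z. z \<in> M \<inter> U \<Longrightarrow> g z = ereal (h z)"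
    using ps unfolding partly_smooth_def by blast
  have "xb \<in> M" using sub unfolding C2_submanifold_at_def by blast
  have "open U" "isCont h xb"
    using U has_derivative_continuous unfolding C2_on_def by blast+
  have hlim: "(\<lambda>n. h (Z (k n))) \<longlonglongrightarrow> h xb" by (rule isCont_tendsto_compose[OF \<open>isCont h xb\<close> Zk])
  \<comment> \<open>The prox-regularity radius depends on the reference subgradient:
    \<open>vb\<close> serves the inequality based at \<open>X\<close>, and \<open>vb + e d\<close>
    the one based at \<open>Z\<close>.\<close>
  obtain \<epsilon>0 where \<epsilon>0: "\<epsilon>0 > 0" "\<And>x x' v. v \<in> limiting_subdiff g x \<Longrightarrow> norm (x - xb) < \<epsilon>0 \<Longrightarrow> norm (x' - xb) < \<epsilon>0 \<Longrightarrow>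
       norm (v - vb) < \<epsilon>0 \<Longrightarrow> g x < g xb + ereal \<epsilon>0 \<Longrightarrow> g x' \<ge> g x + ereal (v \<bullet> (x' - x) - r / 2 * (norm (x' - x))\<^sup>2)"
    using reg v0 unfolding prox_regular_def by metis
  obtain \<epsilon>1 where \<epsilon>1: "\<epsilon>1 > 0" "\<And>x x' v. v \<in> limiting_subdiff g x \<Longrightarrow> norm (x - xb) < \<epsilon>1 \<Longrightarrow> norm (x' - xb) < \<epsilon>1 \<Longrightarrow>
       norm (v - (vb + e *\<^sub>R d)) < \<epsilon>1 \<Longrightarrow> g x < g xb + ereal \<epsilon>1 \<Longrightarrow> g x' \<ge> g x + ereal (v \<bullet> (x' - x) - r / 2 * (norm (x' - x))\<^sup>2)"
    using reg v1 unfolding prox_regular_def by metis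
  define \<epsilon> where "\<epsilon> = min \<epsilon>0 \<epsilon>1"
  have \<epsilon>: "\<epsilon> > 0" "\<epsilon> \<le> \<epsilon>0" "\<epsilon> \<le> \<epsilon>1" using \<epsilon>0(1) \<epsilon>1(1) by (auto simp: \<epsilon>_def)
  have gXk: "\<forall>\<^sub>F n in sequentially. g (X (m (k n))) < g xb + ereal \<epsilon>0"
    using gX[OF \<epsilon>0(1)] mk by (rule eventually_compose_filterlim)
  have "\<forall>\<^sub>F n in sequentially. (w n - V (m (k n))) \<bullet> D (k n) \<le> r * norm (X (m (k n)) - Z (k n))"
    using tendstoD[OF Xk \<epsilon>(1)] tendstoD[OF Zk \<epsilon>(1)] tendstoD[OF Vk \<epsilon>(1)] tendstoD[OF w \<epsilon>(1)]
      tendstoD[OF hlim \<epsilon>(1)] wS gXk topological_tendstoD[OF Zk \<open>open U\<close> U(1)]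
  proof eventually_elim
    case (elim n)
    define x z u where "x = X (m (k n))" and "z = Z (k n)" and "u = V (m (k n))"
    have gz: "g z = ereal (h z)" "g xb = ereal (h xb)"
      using gh elim(8) U(1) ZM \<open>xb \<in> M\<close> by (auto simp: z_def)
    have u: "u \<in> limiting_subdiff g x" using V(1) by (simp add: u_def x_def)
    then obtain a where a: "g x = ereal a" unfolding limiting_subdiff_def by auto
    have 1: "g z \<ge> g x + ereal (u \<bullet> (z - x) - r / 2 * (norm (z - x))\<^sup>2)"
      by (rule \<epsilon>0(2)[OF u]) (use elim \<epsilon> in \<open>auto simp: x_def z_def u_def dist_norm\<close>)
    have 2: "g x \<ge> g z + ereal (w n \<bullet> (x - z) - r / 2 * (norm (x - z))\<^sup>2)"
      by (rule \<epsilon>1(2)) (use elim \<epsilon> gz in \<open>auto simp: x_def z_def u_def dist_norm\<close>)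
    have "(w n - u) \<bullet> (x - z) \<le> r * (norm (x - z))\<^sup>2"
      using 1 2 unfolding a gz by (simp add: inner_diff norm_minus_commute)
    \<comment> \<open>Dividing by the distance turns the quadratic error into one that tends to 0,
      while the left side tends to \<open>e\<close>.\<close>
    then have "((w n - u) \<bullet> (x - z)) / norm (x - z) \<le> r * (norm (x - z))\<^sup>2 / norm (x - z)"
      by (rule divide_right_mono) simp
    moreover have "(w n - u) \<bullet> D (k n) = ((w n - u) \<bullet> (x - z)) / norm (x - z)"
      by (simp add: D_def x_def z_def divide_inverse mult.commute)
    ultimately show ?case
      using ne[of "k n"] unfolding x_def z_def u_def by (simp add: power2_eq_square)
  qed
  moreover have "(\<lambda>n. (w n - V (m (k n))) \<bullet> D (k n)) \<longlonglongrightarrow> (vb + e *\<^sub>R d - vb) \<bullet> d"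
    using k(2) unfolding o_def by (intro tendsto_intros w Vk)
  moreover have "(\<lambda>n. r * norm (X (m (k n)) - Z (k n))) \<longlonglongrightarrow> r * norm (xb - xb)"
    by (intro tendsto_intros Xk Zk)
  ultimately have "(vb + e *\<^sub>R d - vb) \<bullet> d \<le> r * norm (xb - xb)"
    by (intro tendsto_le[OF sequentially_bot])
  then have "e * (d \<bullet> d) \<le> 0" by simp
  moreover have "d \<bullet> d = 1" using d by (simp add: dot_square_norm)
  ultimately show False using e by simp
qed

text \<open>If no radius worked, there would be inputs tending to \<open>xb\<close> with outputs off
  \<open>M\<close>. Calmness makes the outputs tend to \<open>xb\<close>, and the proximal residuals
  \<open>V\<close> are subgradients tending to \<open>- grad f xb\<close>, a relative interior point
  by criticality; this contradicts identification along sequences.\<close>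

lemma prox_grad_identification:
  fixes f :: "'a::euclidean_space \<Rightarrow> real"
  assumes "proper g" and lip: "L-lipschitz_on UNIV (grad f)"
    and "0 < \<gamma>" "r < 1 / \<gamma>" and scp: "structured_critical_point r f g M xb"
  obtains \<delta> where "\<delta> > 0"
    "\<And>x y. norm (y - xb) < \<delta> \<Longrightarrow> x \<in> prox \<gamma> g (y - \<gamma> *\<^sub>R grad f y) \<Longrightarrow> x \<in> M"
proof (rule ccontr)
  note scp = scp[unfolded structured_critical_point_def]
  assume "\<not> thesis"
  then have "\<exists>x y. norm (y - xb) < inverse (Suc n) \<and> x \<in> prox \<gamma> g (y - \<gamma> *\<^sub>R grad f y) \<and> x \<notin> M" for n
    using that[of "inverse (Suc n)"] by fastforce
  then obtain X Y where Yd: "\<And>n. norm (Y n - xb) < inverse (Suc n)"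
    and X: "\<And>n. X n \<in> prox \<gamma> g (Y n - \<gamma> *\<^sub>R grad f (Y n))" and XM: "\<And>n. X n \<notin> M"
    by metis
  have r: "r > 0" using scp unfolding prox_regular_def by blast
  have xb: "xb \<in> prox (1 / r) g (xb - (1 / r) *\<^sub>R grad f xb)" using scp by simp
  have "(\<lambda>n. Y n - xb) \<longlonglongrightarrow> 0"
    by (rule Lim_null_comparison[OF _ LIMSEQ_inverse_real_of_nat]) (simp add: less_imp_le Yd del: of_nat_Suc)
  then have Y: "Y \<longlonglongrightarrow> xb" by (rule LIM_zero_cancel)
  define C where "C = 2 * (L + 1 / \<gamma>) / (1 / \<gamma> - r)"
  have calm: "norm (X n - xb) \<le> C * norm (Y n - xb)" for n
    using prox_grad_calm[OF assms(1) lip \<open>0 < \<gamma>\<close> r assms(4) xb X, of n] assms(4)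
    by (simp add: C_def pos_le_divide_eq mult.commute)
  have "(\<lambda>n. C * norm (Y n - xb)) \<longlonglongrightarrow> C * norm (xb - xb)" by (intro tendsto_intros Y)
  then have "(\<lambda>n. C * norm (Y n - xb)) \<longlonglongrightarrow> 0" by simp
  then have "(\<lambda>n. X n - xb) \<longlonglongrightarrow> 0"
    by (rule Lim_null_comparison[rotated]) (simp add: calm)
  then have Xl: "X \<longlonglongrightarrow> xb" by (rule LIM_zero_cancel)
  have "isCont (grad f) xb"
    using lipschitz_on_continuous_on[OF lip] by (simp add: continuous_on_eq_continuous_at)
  then have Gl: "(\<lambda>n. grad f (Y n)) \<longlonglongrightarrow> grad f xb" using Y by (rule isCont_tendsto_compose)
  define V where "V n = (Y n - \<gamma> *\<^sub>R grad f (Y n) - X n) /\<^sub>R \<gamma>" for n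
  have "\<forall>\<^sub>F n in sequentially. X n \<in> M"
  proof (rule partly_smooth_identification[where V = V and vb = "- grad f xb" and r = r])
    show "V n \<in> limiting_subdiff g (X n)" for n
      unfolding V_def using prox_subgradient[OF assms(1) X \<open>0 < \<gamma>\<close>] regular_subset_limiting_subdiff by blast
    have "V \<longlonglongrightarrow> (xb - \<gamma> *\<^sub>R grad f xb - xb) /\<^sub>R \<gamma>"
      unfolding V_def by (intro tendsto_intros Y Xl Gl)
    then show "V \<longlonglongrightarrow> - grad f xb" using \<open>0 < \<gamma>\<close> by simp
    have "0 \<in> (+) (grad f xb) ` rel_interior (limiting_subdiff g xb)"
      using scp by (simp add: rel_interior_translation)
    then show "- grad f xb \<in> rel_interior (limiting_subdiff g xb)"
      by (auto simp: add_eq_0_iff)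
    show "\<forall>\<^sub>F n in sequentially. g (X n) < g xb + ereal \<epsilon>" if "\<epsilon> > 0" for \<epsilon>
    proof -
      obtain b where b: "g xb = ereal b" using prox_finite[OF assms(1) xb] by auto
      \<comment> \<open>\<open>B n\<close> bounds \<open>g (X n)\<close> by testing proximal
        optimality against \<open>xb\<close>, and it tends to \<open>g xb\<close>.\<close>
      define B where "B n = b + (xb - X n) \<bullet> (X n - (Y n - \<gamma> *\<^sub>R grad f (Y n))) / \<gamma> + (norm (xb - X n))\<^sup>2 / (2 * \<gamma>)" for n
      have "B \<longlonglongrightarrow> b + (xb - xb) \<bullet> (xb - (xb - \<gamma> *\<^sub>R grad f xb)) / \<gamma> + (norm (xb - xb))\<^sup>2 / (2 * \<gamma>)"
        unfolding B_def using \<open>0 < \<gamma>\<close> by (intro tendsto_intros Y Xl Gl) auto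
      then have "\<forall>\<^sub>F n in sequentially. B n < b + \<epsilon>"
        using that by (intro order_tendstoD(2)) auto
      then show ?thesis
      proof eventually_elim
        case (elim n)
        obtain a where a: "g (X n) = ereal a" using prox_finite[OF assms(1) X] by force
        show ?case using prox_ineq_real[OF X a b \<open>0 < \<gamma>\<close>] elim unfolding a b B_def by simp
      qed
    qed
  qed (use scp Xl in auto)
  then show False using XM by (auto dest: eventually_happens)
qed

section \<open>Contraction and superlinear convergence of the iterates\<close>

lemma ennreal_powr_le:
  assumes "d \<le> ennreal t" "0 \<le> t" "0 \<le> p"
  shows "ennreal_powr d p \<le> ennreal (t powr p)"
proof -
  obtain s where s: "d = ennreal s" "0 \<le> s" "s \<le> t"
    using assms(1,2) by (cases d) (auto simp: top_unique)
  then show ?thesis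
    unfolding ennreal_powr_def using assms(3) by (auto intro!: ennreal_leI powr_mono2)
qed

theorem theorem3p2:
  fixes f :: "'a::euclidean_space \<Rightarrow> real" and g :: "'a \<Rightarrow> ereal"
    and L \<gamma> r \<theta> :: real
    and ManAcc :: "'a set \<Rightarrow> 'a \<Rightarrow> 'a"
    and x y :: "nat \<Rightarrow> 'a" and Mk :: "nat \<Rightarrow> 'a set"
    and M :: "'a set" and xbar :: 'a
  assumes "standing_assumptions f g L"
    and "0 < \<gamma>" and "\<gamma> * L < 1"
    and "\<And>N. C2_submanifold N \<Longrightarrow> ManAcc N ` N \<subseteq> N"
    and "structured_prox_run f g \<gamma> ManAcc x y Mk"
    and "\<exists>\<delta>>0. \<forall>k\<ge>1. x k \<in> M \<and> norm (x k - xbar) < \<delta> \<longrightarrow> Mk k = M"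
    and "\<exists>s. strict_mono s \<and> (y \<circ> s) \<longlonglongrightarrow> xbar"
    and "C2_submanifold M"
    and "structured_critical_point r f g M xbar" and "r < 1 / \<gamma>"
    and "0 < \<theta>" and "\<theta> < 1"
    and "superlinear_rate_near (ManAcc M) M xbar (1 + \<theta>)"
  shows "(\<exists>K. \<forall>k\<ge>K. x k \<in> M) \<and>
    x \<longlonglongrightarrow> xbar \<and>
    (\<exists>c>0. \<forall>\<^sub>F k in sequentially.
       riem_dist M (x (Suc k)) xbar \<le> ennreal c * ennreal_powr (riem_dist M (x k) xbar) (1 + \<theta>))"
proof -
  have proper: "proper g" and lip: "L-lipschitz_on UNIV (grad f)"
    using assms(1) unfolding standing_assumptions_def by auto
  note scp = assms(9)[unfolded structured_critical_point_def]
  have r: "0 < r" using scp unfolding prox_regular_def by blast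
  have xb: "xbar \<in> prox (1 / r) g (xbar - (1 / r) *\<^sub>R grad f xbar)" using scp by simp
  obtain p where sub: "C2_submanifold_at p M xbar" using scp unfolding partly_smooth_def by blast
  obtain \<delta>1 where \<delta>1: "\<delta>1 > 0"
    "\<And>x y. norm (y - xbar) < \<delta>1 \<Longrightarrow> x \<in> prox \<gamma> g (y - \<gamma> *\<^sub>R grad f y) \<Longrightarrow> x \<in> M"
    by (fact prox_grad_identification[OF proper lip assms(2,10,9)])
  obtain \<delta>2 where \<delta>2: "\<delta>2 > 0"
    "\<And>a. a \<in> M \<inter> ball xbar \<delta>2 \<Longrightarrow> riem_dist M a xbar \<le> ennreal (3 * norm (a - xbar))"
    by (fact riem_dist_le_norm_near[OF sub])
  obtain \<delta>3 where \<delta>3: "\<delta>3 > 0" "\<And>k. k \<ge> 1 \<Longrightarrow> x k \<in> M \<Longrightarrow> norm (x k - xbar) < \<delta>3 \<Longrightarrow> Mk k = M"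
    using assms(6) by blast
  obtain \<epsilon> q where \<epsilon>: "\<epsilon> > 0" and q: "q > 0"
    and rate: "\<And>a. a \<in> M \<Longrightarrow> riem_dist M a xbar \<le> ennreal \<epsilon> \<Longrightarrow>
       riem_dist M (ManAcc M a) xbar \<le> ennreal q * ennreal_powr (riem_dist M a xbar) (1 + \<theta>)"
    using assms(13) unfolding superlinear_rate_near_def by blast
  define C where "C = 2 * (L + 1 / \<gamma>) / (1 / \<gamma> - r)"
  \<comment> \<open>\<open>C\<close> bounds the proximal step in norm, and 3 converts the norm to
    \<open>riem_dist\<close> near \<open>xbar\<close>.\<close>
  define R where "R = 3 * C"
  define e where "e k = norm (y k - xbar)" for k
  have C: "C > 0"
    unfolding C_def using lipschitz_on_nonneg[OF lip] assms(2,10)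
    by (intro divide_pos_pos mult_pos_pos add_nonneg_pos) auto
  then have R: "R > 0" by (simp add: R_def)
  have xk: "x (Suc k) \<in> prox \<gamma> g (y k - \<gamma> *\<^sub>R grad f (y k))"
    and yk: "y (Suc k) = ManAcc (Mk (Suc k)) (x (Suc k))" for k
    using assms(5) unfolding structured_prox_run_def by fastforce+
  have calm: "norm (x (Suc k) - xbar) \<le> C * e k" for k
    using prox_grad_calm[OF proper lip assms(2) r assms(10) xb xk, of k] assms(10)
    by (simp add: C_def e_def pos_le_divide_eq mult.commute)
  \<comment> \<open>The bounds secure, in turn, identification, the two Euclidean neighbourhoods for
    \<open>x (Suc k)\<close>, the radius of the rate, and contraction: the last one solves
    \<open>q * R powr (1 + \<theta>) * \<delta> powr \<theta> = 1 / 2\<close>.\<close>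
  define \<delta> where "\<delta> = min (min \<delta>1 (min \<delta>2 \<delta>3 / C)) (min (\<epsilon> / R) ((1 / (2 * q * R powr (1 + \<theta>))) powr (1 / \<theta>)))"
  have \<delta>: "\<delta> > 0" using \<delta>1(1) \<delta>2(1) \<delta>3(1) \<epsilon> C R q by (simp add: \<delta>_def)
  have step: "x (Suc k) \<in> M \<and> riem_dist M (x (Suc k)) xbar \<le> ennreal (R * e k) \<and>
      riem_dist M (y (Suc k)) xbar \<le> ennreal q * ennreal_powr (riem_dist M (x (Suc k)) xbar) (1 + \<theta>) \<and>
      e (Suc k) \<le> e k / 2"
    if ek: "e k < \<delta>" for k
  proof -
    have lt: "e k < \<delta>1" "C * e k < \<delta>2" "C * e k < \<delta>3" "R * e k \<le> \<epsilon>"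
      and lt': "e k \<le> (1 / (2 * q * R powr (1 + \<theta>))) powr (1 / \<theta>)"
      using ek C R by (auto simp: \<delta>_def pos_less_divide_eq mult.commute)
    have xM: "x (Suc k) \<in> M" using \<delta>1(2)[OF _ xk] lt(1) by (simp add: e_def)
    have "riem_dist M (x (Suc k)) xbar \<le> ennreal (3 * norm (x (Suc k) - xbar))"
      using xM calm[of k] lt(2) by (intro \<delta>2(2)) (auto simp: dist_norm norm_minus_commute)
    also have "\<dots> \<le> ennreal (R * e k)"
      using calm[of k] by (intro ennreal_leI) (simp add: R_def)
    finally have rx: "riem_dist M (x (Suc k)) xbar \<le> ennreal (R * e k)" .
    have "Mk (Suc k) = M" using \<delta>3(2)[OF _ xM] calm[of k] lt(3) by simp
    moreover have "riem_dist M (x (Suc k)) xbar \<le> ennreal \<epsilon>"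
      using rx ennreal_leI[OF lt(4)] by (rule order_trans)
    ultimately have ry: "riem_dist M (y (Suc k)) xbar \<le> ennreal q * ennreal_powr (riem_dist M (x (Suc k)) xbar) (1 + \<theta>)"
      using rate[OF xM] yk[of k] by simp
    have "ennreal (e (Suc k)) \<le> riem_dist M (y (Suc k)) xbar"
      unfolding e_def by (rule norm_le_riem_dist)
    also note ry
    also have "ennreal q * ennreal_powr (riem_dist M (x (Suc k)) xbar) (1 + \<theta>)
        \<le> ennreal q * ennreal ((R * e k) powr (1 + \<theta>))"
      using rx R assms(11) by (intro mult_left_mono ennreal_powr_le) (auto simp: e_def)
    also have "\<dots> = ennreal (q * (R * e k) powr (1 + \<theta>))"
      using q by (simp add: ennreal_mult)
    finally have "e (Suc k) \<le> q * (R * e k) powr (1 + \<theta>)"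
      using q by (simp add: ennreal_le_iff)
    also have "(R * e k) powr (1 + \<theta>) = R powr (1 + \<theta>) * (e k powr \<theta> * e k)"
      using R by (simp add: powr_mult e_def powr_add)
    also have "q * (R powr (1 + \<theta>) * (e k powr \<theta> * e k)) \<le> q * (R powr (1 + \<theta>) * (1 / (2 * q * R powr (1 + \<theta>)) * e k))"
    proof -
      have "e k powr \<theta> \<le> ((1 / (2 * q * R powr (1 + \<theta>))) powr (1 / \<theta>)) powr \<theta>"
        using lt' assms(11) by (intro powr_mono2) (auto simp: e_def)
      also have "\<dots> = 1 / (2 * q * R powr (1 + \<theta>))"
        using assms(11) q R by (simp add: powr_powr)
      finally show ?thesis
        using q by (intro mult_left_mono mult_right_mono) (auto simp: e_def)
    qed
    also have "\<dots> = e k / 2" using q R by simp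
    finally show ?thesis using xM rx ry by blast
  qed
  \<comment> \<open>The limit point supplies just one good index; from there the halving of
    \<open>e\<close> keeps all later iterates in the neighbourhood.\<close>
  obtain k0 where k0: "e k0 < \<delta>"
  proof -
    obtain s where "(y \<circ> s) \<longlonglongrightarrow> xbar" using assms(7) by blast
    from tendstoD[OF this \<delta>] obtain n where "dist (y (s n)) xbar < \<delta>"
      by (auto dest: eventually_happens)
    then show thesis using that by (simp add: e_def dist_norm)
  qed
  have decay: "e (n + k0) \<le> (1 / 2) ^ n * e k0 \<and> e (n + k0) < \<delta>" for n
  proof (induction n)
    case (Suc n)
    then have "e (Suc (n + k0)) \<le> e (n + k0) / 2" "e (n + k0) \<ge> 0"
      using step by (auto simp: e_def)
    then show ?case using Suc by simp
  qed (use k0 in simp)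
  have close: "e k < \<delta>" if "k \<ge> k0" for k using decay[of "k - k0"] that by simp
  have "(\<lambda>n. (1 / 2) ^ n * e k0) \<longlonglongrightarrow> 0"
    by (intro tendsto_mult_left_zero LIMSEQ_power_zero) simp
  then have "(\<lambda>n. e (n + k0)) \<longlonglongrightarrow> 0"
    by (rule Lim_null_comparison[rotated]) (use decay in \<open>auto simp: e_def\<close>)
  then have e0: "e \<longlonglongrightarrow> 0" by (rule LIMSEQ_offset)
  have "(\<lambda>k. C * e k) \<longlonglongrightarrow> 0" using tendsto_mult_right_zero[OF e0] .
  then have "(\<lambda>k. x (Suc k) - xbar) \<longlonglongrightarrow> 0"
    by (rule Lim_null_comparison[rotated]) (use calm in auto)
  then have "(\<lambda>k. x (Suc k)) \<longlonglongrightarrow> xbar" by (rule LIM_zero_cancel)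
  then have xlim: "x \<longlonglongrightarrow> xbar" by (rule LIMSEQ_imp_Suc)
  \<comment> \<open>The shift by one arises because \<open>x k\<close> is computed from
    \<open>y (k - 1)\<close>.\<close>
  have xM: "x k \<in> M" if "k \<ge> Suc k0" for k
    using step[OF close, of "k - 1"] that by (cases k) auto
  have superlin: "riem_dist M (x (Suc k)) xbar \<le> ennreal (R * q) * ennreal_powr (riem_dist M (x k) xbar) (1 + \<theta>)"
    if k: "k \<ge> Suc k0" for k
  proof -
    \<comment> \<open>Two steps are chained: the proximal step at \<open>k\<close> gives the factor
      \<open>R\<close>, and the manifold update that produced \<open>y k\<close>, covered by
      \<open>step\<close> at \<open>j\<close>, gives \<open>q\<close> and the power.\<close>
    obtain j where j: "k = Suc j" "j \<ge> k0" using k by (cases k) auto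
    have "riem_dist M (x (Suc k)) xbar \<le> ennreal (R * e k)" using step[OF close, of k] k by simp
    also have "\<dots> = ennreal R * ennreal (e k)" using R by (simp add: ennreal_mult e_def)
    also have "\<dots> \<le> ennreal R * riem_dist M (y k) xbar"
      unfolding e_def by (intro mult_left_mono norm_le_riem_dist) simp
    also have "\<dots> \<le> ennreal R * (ennreal q * ennreal_powr (riem_dist M (x k) xbar) (1 + \<theta>))"
      using step[OF close[OF j(2)]] unfolding j(1) by (intro mult_left_mono) auto
    also have "\<dots> = ennreal (R * q) * ennreal_powr (riem_dist M (x k) xbar) (1 + \<theta>)"
      using R q by (simp add: ennreal_mult mult.assoc)
    finally show ?thesis .
  qed
  show ?thesis
  proof (intro conjI)
    show "\<exists>K. \<forall>k\<ge>K. x k \<in> M" using xM by blast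
    show "x \<longlonglongrightarrow> xbar" by (fact xlim)
    show "\<exists>c>0. \<forall>\<^sub>F k in sequentially.
       riem_dist M (x (Suc k)) xbar \<le> ennreal c * ennreal_powr (riem_dist M (x k) xbar) (1 + \<theta>)"
      using superlin R q by (intro exI[of _ "R * q"] conjI eventually_sequentiallyI[of "Suc k0"]) auto
  qed
qed

end
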